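(* Let $0<\alpha<1$ and let $r \ge 1/\alpha^4$ be an integer. Then the number of $\alpha$-equiangular lines in $\mathbb{R}^r$ is at most $$r + r\cdot \max\left\{ \frac{66 \log^2 \log_{1/\alpha} r}{\log_{1/\alpha} r},\ 17\alpha\log\frac{2}{\alpha}\right\}.$$
   Context: A family of lines through the origin in $\mathbb{R}^r$ is $\alpha$-equiangular if the acute angle between any two distinct lines equals $\arccos\alpha$. $\log$ denotes the base-$2$ logarithm and $\log_{1/\alpha} r = \log r/\log(1/\alpha)$. *)

theory Defs
  imports "HOL-Analysis.Analysis"
begin

definition vec_angle :: "'a::real_inner \<Rightarrow> 'a \<Rightarrow> real" where
  "vec_angle u v = arccos ((u \<bullet> v) / (norm u * norm v))"

definition is_line :: "'a::euclidean_space set \<Rightarrow> bool" where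
  "is_line L \<longleftrightarrow> subspace L \<and> dim L = 1"

text \<open>Nonzero vectors of two lines through the origin form only two angles, \<open>\<theta>\<close> and \<open>pi - \<theta>\<close>
  (according to orientation), so the infimum below is the smaller of the two,
  i.e. the non-obtuse one.\<close>

definition line_angle :: "'a::euclidean_space set \<Rightarrow> 'a set \<Rightarrow> real" where
  "line_angle L M = Inf {vec_angle u v | u v. u \<in> L - {0} \<and> v \<in> M - {0}}"

definition equiangular :: "real \<Rightarrow> 'a::euclidean_space set set \<Rightarrow> bool" where
  "equiangular \<alpha> \<L> \<longleftrightarrow>
     (\<forall>L\<in>\<L>. is_line L) \<and>
     (\<forall>L\<in>\<L>. \<forall>M\<in>\<L>. L \<noteq> M \<longrightarrow> line_angle L M = arccos \<alpha>)"

end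

theory Submission
  imports Defs
begin

text \<open>
  Orient unit vectors along the lines so that the length of their sum is maximal, and join two
  vectors by an edge if their inner product is \<open>-\<alpha>\<close>. With \<open>\<lambda> = (1 - \<alpha>) / (2 \<alpha>)\<close>, positivity of the
  Gram matrix says that the adjacency matrix \<open>A\<close> satisfies \<open>x\<^sup>T A x \<le> \<lambda> |x|\<^sup>2\<close> on vectors of sum zero,
  while linear dependencies of sum zero are eigenvectors of \<open>A\<close> for \<open>\<lambda>\<close>, so \<open>\<lambda>\<close> has
  multiplicity at least \<open>n - r - 1\<close>.

  Projecting \<open>v \<otimes> u\<close>, where \<open>u\<close> is the sum of all vectors, onto the span of the matrices \<open>w \<otimes> w\<close>
  bounds all degrees by a multiple of \<open>\<alpha>\<^sup>-\<^sup>3\<close>, and testing the quadratic form on a star improves this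
  to a multiple of \<open>\<lambda>\<^sup>2\<close>. Comparing the trace of \<open>A\<close>, which vanishes, with its Frobenius norm now gives
  \<open>n \<le> 3 r\<close>, which settles the case where the claimed maximum \<open>x\<close> is at least 2.

  If \<open>x < 2\<close>, then \<open>r\<close> is huge compared with \<open>1 / \<alpha>\<close>, and each vertex starts at most about
  \<open>\<lambda>\<^sup>2\<^sup>s\<close> closed walks of length \<open>2 s\<close>, where \<open>s\<close> is of order \<open>log\<^bsub>1/\<alpha>\<^esub> r\<close>. Closed walks
  meeting only \<open>k\<close> vertices are negligible as long as \<open>k\<close> is below \<open>\<lambda> / 2\<close> and \<open>s / log s\<close>. Most others
  are destroyed by deleting greedily about \<open>n x / 4\<close> vertices. The trace of the \<open>2 s\<close>-th
  power then bounds the multiplicity of \<open>\<lambda>\<close> in the remaining graph.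
\<close>

section \<open>Hitting sets and orthonormal families\<close>

definition outer :: "real ^ 'n \<Rightarrow> real ^ 'n \<Rightarrow> real ^ 'n ^ 'n" where
  "outer a b = (\<chi> i j. a $ i * b $ j)"

text \<open>The inner product of \<open>real ^ 'n ^ 'n\<close> is the Frobenius product, so rank-one
  matrices turn a product of inner products into a single one. This is how the constant squares
  \<open>\<alpha>\<^sup>2\<close> become Gram entries later.\<close>

lemma inner_outer: "outer a b \<bullet> outer c d = (a \<bullet> c) * (b \<bullet> d)"
  by (simp add: outer_def inner_vec_def sum_product algebra_simps)

lemma norm_outer_sq: "(norm (outer a b))\<^sup>2 = (norm a)\<^sup>2 * (norm b)\<^sup>2"
  by (simp add: power2_norm_eq_inner inner_outer)

text \<open>By double counting, some element of \<open>V\<close> lies in a fraction of at least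
  \<open>k / card V\<close> of the sets not yet hit, and adding it to \<open>T\<close> shrinks their
  number accordingly. The family is indexed because distinct walks may share a vertex set and must
  be counted separately.\<close>

lemma greedy_hitting_set:
  fixes S :: "'p \<Rightarrow> 'v set"
  assumes "finite W" "finite V" "V \<noteq> {}" "k \<le> card V"
    and sub: "\<And>p. p \<in> W \<Longrightarrow> S p \<subseteq> V" and large: "\<And>p. p \<in> W \<Longrightarrow> k \<le> card (S p)"
  shows "\<exists>T\<subseteq>V. card T \<le> t \<and>
    real (card {p \<in> W. S p \<inter> T = {}}) \<le> (1 - real k / real (card V)) ^ t * real (card W)"
proof (induction t)
  case 0
  show ?case by (rule exI[of _ "{}"]) simp
next
  case (Suc t)
  define n where "n = card V"
  have n: "n > 0" using assms by (simp add: n_def card_gt_0_iff)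
  from Suc obtain T where T: "T \<subseteq> V" "card T \<le> t"
    "real (card {p \<in> W. S p \<inter> T = {}}) \<le> (1 - real k / real n) ^ t * real (card W)"
    by (auto simp: n_def)
  define W' where "W' = {p \<in> W. S p \<inter> T = {}}"
  have fW': "finite W'" using assms by (simp add: W'_def)
  have "\<exists>v\<in>V. real k * real (card W') / real n \<le> real (card {p \<in> W'. v \<in> S p})"
  proof (rule ccontr)
    assume "\<not> ?thesis"
    then have "(\<Sum>v\<in>V. real (card {p \<in> W'. v \<in> S p})) < (\<Sum>v\<in>V. real k * real (card W') / real n)"
      using assms by (intro sum_strict_mono) auto
    also have "\<dots> = real k * real (card W')"
      using n by (simp add: n_def)
    also have "\<dots> = (\<Sum>p\<in>W'. real k)" by simp
    also have "\<dots> \<le> (\<Sum>p\<in>W'. real (card {v \<in> V. v \<in> S p}))"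
    proof (rule sum_mono)
      fix p assume "p \<in> W'"
      then have "p \<in> W" by (simp add: W'_def)
      then have "{v \<in> V. v \<in> S p} = S p" using sub by auto
      then show "real k \<le> real (card {v \<in> V. v \<in> S p})" using large[OF \<open>p \<in> W\<close>] by simp
    qed
    also have "\<dots> = (\<Sum>v\<in>V. real (card {p \<in> W'. v \<in> S p}))"
    proof -
      have "(\<Sum>p\<in>W'. card {v \<in> V. v \<in> S p}) = (\<Sum>v\<in>V. card {p \<in> W'. v \<in> S p})"
        using sum.swap_restrict[OF fW' \<open>finite V\<close>, of "\<lambda>_ _. 1::nat" "\<lambda>p v. v \<in> S p"] by simp
      then show ?thesis by (simp flip: of_nat_sum)
    qed
    finally show False by simp
  qed
  then obtain v where v: "v \<in> V" "real k * real (card W') / real n \<le> real (card {p \<in> W'. v \<in> S p})"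
    by blast
  have eq: "{p \<in> W. S p \<inter> insert v T = {}} = W' - {p \<in> W'. v \<in> S p}"
    by (auto simp: W'_def)
  have "real (card {p \<in> W. S p \<inter> insert v T = {}}) = real (card W') - real (card {p \<in> W'. v \<in> S p})"
    unfolding eq using fW' by (subst card_Diff_subset) (auto intro!: of_nat_diff card_mono)
  also have "\<dots> \<le> (1 - real k / real n) * real (card W')"
    using v(2) by (simp add: algebra_simps)
  also have "\<dots> \<le> (1 - real k / real n) * ((1 - real k / real n) ^ t * real (card W))"
    using T(3) n assms(4) by (intro mult_left_mono) (auto simp: W'_def n_def)
  finally have "real (card {p \<in> W. S p \<inter> insert v T = {}}) \<le> (1 - real k / real n) ^ Suc t * real (card W)"
    by (simp add: algebra_simps)
  moreover have "card (insert v T) \<le> Suc t"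
    using T(2) card_insert_le_m1 finite_subset[OF T(1) \<open>finite V\<close>] by (simp add: card_insert_if)
  ultimately show ?case using T(1) v(1) by (intro exI[of _ "insert v T"]) (auto simp: n_def)
qed

text \<open>Gram-Schmidt for functions, with the inner product summed over \<open>H\<close>.
  Spanning is stated dually: whatever is orthogonal to \<open>F\<close> is orthogonal to each
  \<open>g i\<close>. A function whose residual \<open>y\<close> vanishes on \<open>H\<close> adds
  nothing to \<open>F\<close>, hence only \<open>card F \<le> card I\<close>.\<close>

lemma orthonormal_basis_on:
  fixes g :: "'l \<Rightarrow> 'v \<Rightarrow> real"
  assumes "finite I" "finite H"
  shows "\<exists>F. finite F \<and> card F \<le> card I \<and>
    (\<forall>f\<in>F. \<forall>f'\<in>F. (\<Sum>h\<in>H. f h * f' h) = (if f = f' then 1 else 0)) \<and>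
    (\<forall>x. (\<forall>f\<in>F. (\<Sum>h\<in>H. x h * f h) = 0) \<longrightarrow> (\<forall>i\<in>I. (\<Sum>h\<in>H. x h * g i h) = 0))"
  using \<open>finite I\<close>
proof (induction I)
  case empty
  show ?case by (rule exI[of _ "{}"]) simp
next
  case (insert i I)
  from insert.IH obtain F where F: "finite F" "card F \<le> card I"
    and on': "\<forall>f\<in>F. \<forall>f'\<in>F. (\<Sum>h\<in>H. f h * f' h) = (if f = f' then 1 else 0)"
    and sp': "\<forall>x. (\<forall>f\<in>F. (\<Sum>h\<in>H. x h * f h) = 0) \<longrightarrow> (\<forall>i\<in>I. (\<Sum>h\<in>H. x h * g i h) = 0)"
    by (elim exE conjE)
  have on: "(\<Sum>h\<in>H. f h * f' h) = (if f = f' then 1 else 0)" if "f \<in> F" "f' \<in> F" for f f'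
    using on' that by blast
  have sp: "(\<Sum>h\<in>H. x h * g i h) = 0" if "\<And>f. f \<in> F \<Longrightarrow> (\<Sum>h\<in>H. x h * f h) = 0" "i \<in> I" for x i
    using sp'[rule_format, of x i] that by simp
  define c where "c f = (\<Sum>h\<in>H. g i h * f h)" for f
  define y where "y h = g i h - (\<Sum>f\<in>F. c f * f h)" for h
  define N where "N = (\<Sum>h\<in>H. y h * y h)"
  have gy: "(\<Sum>h\<in>H. x h * g i h) = (\<Sum>h\<in>H. x h * y h)" if "\<And>f. f \<in> F \<Longrightarrow> (\<Sum>h\<in>H. x h * f h) = 0" for x
  proof -
    have "(\<Sum>h\<in>H. x h * (\<Sum>f\<in>F. c f * f h)) = (\<Sum>h\<in>H. \<Sum>f\<in>F. c f * (x h * f h))"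
      by (simp add: sum_distrib_left algebra_simps)
    also have "\<dots> = (\<Sum>f\<in>F. c f * (\<Sum>h\<in>H. x h * f h))"
      by (subst sum.swap) (simp add: sum_distrib_left)
    also have "\<dots> = 0" using that by simp
    finally show ?thesis by (simp add: y_def algebra_simps sum_subtractf)
  qed
  have yf: "(\<Sum>h\<in>H. y h * f h) = 0" if "f \<in> F" for f
  proof -
    have "(\<Sum>h\<in>H. (\<Sum>f'\<in>F. c f' * f' h) * f h) = (\<Sum>h\<in>H. \<Sum>f'\<in>F. c f' * (f' h * f h))"
      by (simp add: sum_distrib_right mult.assoc)
    also have "\<dots> = (\<Sum>f'\<in>F. c f' * (\<Sum>h\<in>H. f' h * f h))"
      by (subst sum.swap) (simp add: sum_distrib_left)
    also have "\<dots> = (\<Sum>f'\<in>F. if f' = f then c f' else 0)"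
      using on that by (intro sum.cong) auto
    also have "\<dots> = c f" using that F by simp
    finally show ?thesis by (simp add: y_def algebra_simps sum_subtractf c_def)
  qed
  show ?case
  proof (cases "N = 0")
    case True
    then have y0: "y h = 0" if "h \<in> H" for h
      using that \<open>finite H\<close> sum_nonneg_eq_0_iff[of H "\<lambda>h. y h * y h"] by (auto simp: N_def)
    show ?thesis
    proof (rule exI[of _ F], intro conjI)
      show "card F \<le> card (insert i I)" using F insert by simp
    qed (use F on sp gy y0 in auto)
  next
    case False
    then have N: "N > 0" by (metis N_def less_eq_real_def sum_nonneg zero_le_square)
    define e where "e h = y h / sqrt N" for h
    have ee: "(\<Sum>h\<in>H. e h * e h) = 1"
      using N by (simp add: e_def N_def[symmetric] flip: sum_divide_distrib)
    have ef: "(\<Sum>h\<in>H. e h * f h) = 0" if "f \<in> F" for f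
      using yf[OF that] by (simp add: e_def flip: sum_divide_distrib)
    have ef': "(\<Sum>h\<in>H. f h * e h) = 0" if "f \<in> F" for f
      using ef[OF that] by (simp add: mult.commute)
    have eF: "e \<notin> F" using ee ef by force
    show ?thesis
    proof (rule exI[of _ "insert e F"], intro conjI)
      show "finite (insert e F)" "card (insert e F) \<le> card (insert i I)"
        using F insert eF by auto
      show "\<forall>f\<in>insert e F. \<forall>f'\<in>insert e F. (\<Sum>h\<in>H. f h * f' h) = (if f = f' then 1 else 0)"
        using on ee ef ef' eF by auto
      show "\<forall>x. (\<forall>f\<in>insert e F. (\<Sum>h\<in>H. x h * f h) = 0) \<longrightarrow>
         (\<forall>j\<in>insert i I. (\<Sum>h\<in>H. x h * g j h) = 0)"
      proof (intro allI impI ballI)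
        fix x j assume x: "\<forall>f\<in>insert e F. (\<Sum>h\<in>H. x h * f h) = 0" and j: "j \<in> insert i I"
        have "(\<Sum>h\<in>H. x h * y h) / sqrt N = (\<Sum>h\<in>H. x h * e h)"
          by (simp add: e_def sum_divide_distrib)
        also have "\<dots> = 0" using x by simp
        finally have "(\<Sum>h\<in>H. x h * y h) = 0" using N by simp
        then show "(\<Sum>h\<in>H. x h * g j h) = 0" using x gy[of x] sp[of x j] j by auto
      qed
    qed
  qed
qed

section \<open>The graph of negative inner products\<close>

locale equiangular_vectors =
  fixes V :: "(real ^ 'n) set" and \<alpha> :: real
  assumes finite_V: "finite V" and V_ne: "V \<noteq> {}"
    and unit: "v \<in> V \<Longrightarrow> v \<bullet> v = 1"
    and angle: "v \<in> V \<Longrightarrow> w \<in> V \<Longrightarrow> v \<noteq> w \<Longrightarrow> \<bar>v \<bullet> w\<bar> = \<alpha>"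
    and alpha_pos: "0 < \<alpha>" and alpha_less_1: "\<alpha> < 1"
begin

definition A :: "real ^ 'n \<Rightarrow> real ^ 'n \<Rightarrow> real" where
  "A v w = (if v \<bullet> w < 0 then 1 else 0)"

definition deg :: "real ^ 'n \<Rightarrow> real" where
  "deg v = (\<Sum>w\<in>V. A v w)"

definition quad :: "(real ^ 'n \<Rightarrow> real) \<Rightarrow> real" where
  "quad x = (\<Sum>v\<in>V. \<Sum>w\<in>V. A v w * (x v * x w))"

text \<open>The Gram matrix is \<open>\<alpha> J - 2 \<alpha> A + (1 - \<alpha>) I\<close> with
  \<open>J\<close> all ones. On vectors of sum zero \<open>J\<close> drops out, and positivity
  becomes an upper bound \<open>lam\<close> for the form of \<open>A\<close>.\<close>

definition lam :: real where
  "lam = (1 - \<alpha>) / (2 * \<alpha>)"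

abbreviation n :: real where
  "n \<equiv> real (card V)"

lemma n_pos: "n > 0"
  using finite_V V_ne by (simp add: card_gt_0_iff)

lemma lam_pos: "lam > 0"
  using alpha_pos alpha_less_1 by (simp add: lam_def)

lemma A_nonneg: "A v w \<ge> 0" and A_sq: "A v w * A v w = A v w"
  and A_commute: "A v w = A w v"
  by (simp_all add: A_def inner_commute)

lemma A_self: "v \<in> V \<Longrightarrow> A v v = 0"
  by (simp add: A_def unit)

lemma deg_nonneg: "deg v \<ge> 0"
  by (simp add: deg_def A_nonneg sum_nonneg)

lemma inner_eq:
  assumes "v \<in> V" "w \<in> V"
  shows "v \<bullet> w = \<alpha> - 2 * \<alpha> * A v w + (if v = w then 1 - \<alpha> else 0)"
  using unit[OF assms(1)] angle[OF assms] alpha_pos by (auto simp: A_def split: if_splits)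

text \<open>One row of the Gram matrix, restricted to \<open>H\<close> and applied to
  \<open>x\<close>. Proper subsets \<open>H\<close> occur once vertices have been deleted.\<close>

lemma sum_inner_eq:
  assumes "v \<in> V" "H \<subseteq> V" "v \<in> H"
  shows "(\<Sum>w\<in>H. x w * (v \<bullet> w)) = \<alpha> * (\<Sum>w\<in>H. x w) - 2 * \<alpha> * (\<Sum>w\<in>H. A v w * x w) + (1 - \<alpha>) * x v"
proof -
  have fH: "finite H" using assms finite_V finite_subset by blast
  have "(\<Sum>w\<in>H. x w * (v \<bullet> w)) =
      (\<Sum>w\<in>H. \<alpha> * x w - 2 * \<alpha> * (A v w * x w) + (if v = w then (1 - \<alpha>) * x w else 0))"
    using assms by (intro sum.cong refl) (auto simp: inner_eq algebra_simps)
  also have "\<dots> = \<alpha> * (\<Sum>w\<in>H. x w) - 2 * \<alpha> * (\<Sum>w\<in>H. A v w * x w) + (1 - \<alpha>) * x v"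
    using fH assms by (simp add: sum.distrib sum_subtractf sum_distrib_left)
  finally show ?thesis .
qed

text \<open>Cauchy-Schwarz for \<open>outer p q\<close> and the combination \<open>T\<close> of the
  matrices \<open>outer k k\<close>. These have Gram matrix
  \<open>(1 - \<alpha>\<^sup>2) I + \<alpha>\<^sup>2 J\<close>, and the \<open>J\<close> part
  vanishes because \<open>h\<close> sums to zero.\<close>

lemma projection:
  assumes h: "(\<Sum>k\<in>V. h k) = 0"
  shows "(\<Sum>k\<in>V. (p \<bullet> k) * (q \<bullet> k) * h k)\<^sup>2 \<le> (norm p)\<^sup>2 * (norm q)\<^sup>2 * (\<Sum>k\<in>V. (h k)\<^sup>2)"
proof -
  define T where "T = (\<Sum>k\<in>V. h k *\<^sub>R outer k k)"
  have "outer p q \<bullet> T = (\<Sum>k\<in>V. (p \<bullet> k) * (q \<bullet> k) * h k)"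
    by (simp add: T_def inner_sum_right inner_outer algebra_simps)
  moreover have "(norm T)\<^sup>2 = (1 - \<alpha>\<^sup>2) * (\<Sum>k\<in>V. (h k)\<^sup>2)"
  proof -
    have sq: "(k \<bullet> l) * (k \<bullet> l) = \<alpha>\<^sup>2 + (if k = l then 1 - \<alpha>\<^sup>2 else 0)" if "k \<in> V" "l \<in> V" for k l
      using unit[OF that(1)] angle[OF that] power2_abs[of "k \<bullet> l"] by (auto simp: power2_eq_square)
    have "(norm T)\<^sup>2 = (\<Sum>k\<in>V. \<Sum>l\<in>V. h k * h l * ((k \<bullet> l) * (k \<bullet> l)))"
      unfolding T_def power2_norm_eq_inner
      by (simp add: inner_sum_left inner_sum_right inner_outer sum_distrib_left algebra_simps)
         (intro sum.cong refl, simp add: inner_commute)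
    also have "\<dots> = (\<Sum>k\<in>V. \<Sum>l\<in>V. \<alpha>\<^sup>2 * (h k * h l) + (if k = l then (1 - \<alpha>\<^sup>2) * (h k * h l) else 0))"
      by (intro sum.cong refl) (simp add: sq algebra_simps)
    also have "\<dots> = \<alpha>\<^sup>2 * ((\<Sum>k\<in>V. h k) * (\<Sum>l\<in>V. h l)) + (1 - \<alpha>\<^sup>2) * (\<Sum>k\<in>V. (h k)\<^sup>2)"
    proof -
      have "(\<Sum>k\<in>V. \<Sum>l\<in>V. \<alpha>\<^sup>2 * (h k * h l)) = \<alpha>\<^sup>2 * ((\<Sum>k\<in>V. h k) * (\<Sum>l\<in>V. h l))"
        by (subst sum_product) (simp only: sum_distrib_left)
      moreover have "(\<Sum>k\<in>V. (1 - \<alpha>\<^sup>2) * (h k * h k)) = (1 - \<alpha>\<^sup>2) * (\<Sum>k\<in>V. (h k)\<^sup>2)"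
        by (simp only: sum_distrib_left power2_eq_square)
      ultimately show ?thesis using finite_V by (simp add: sum.distrib)
    qed
    finally show ?thesis using h by simp
  qed
  then have "(norm T)\<^sup>2 \<le> (\<Sum>k\<in>V. (h k)\<^sup>2)"
    using mult_left_le_one_le[of "\<Sum>k\<in>V. (h k)\<^sup>2" "1 - \<alpha>\<^sup>2"] alpha_pos alpha_less_1
    by (simp add: sum_nonneg power_le_one)
  moreover have "(outer p q \<bullet> T)\<^sup>2 \<le> (norm p)\<^sup>2 * (norm q)\<^sup>2 * (norm T)\<^sup>2"
    using Cauchy_Schwarz_ineq[of "outer p q" T]
    by (simp only: power2_norm_eq_inner[symmetric] norm_outer_sq)
  ultimately show ?thesis
    by (smt (verit) mult_left_mono mult_nonneg_nonneg zero_le_power2)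
qed

text \<open>Expand the squared norm of the combination of the vectors with coefficients
  \<open>x\<close>; the all-ones part of the Gram matrix contributes nothing.\<close>

lemma quad_le_of_sum_zero:
  assumes "(\<Sum>v\<in>V. x v) = 0"
  shows "quad x \<le> lam * (\<Sum>v\<in>V. (x v)\<^sup>2)"
proof -
  have "0 \<le> (norm (\<Sum>v\<in>V. x v *\<^sub>R v))\<^sup>2" by simp
  also have "\<dots> = (\<Sum>v\<in>V. x v * (\<Sum>w\<in>V. x w * (v \<bullet> w)))"
    unfolding power2_norm_eq_inner
    by (simp add: inner_sum_left inner_sum_right sum_distrib_left)
       (intro sum.cong refl, simp add: algebra_simps inner_commute)
  also have "\<dots> = (\<Sum>v\<in>V. (1 - \<alpha>) * (x v)\<^sup>2 - 2 * \<alpha> * (\<Sum>w\<in>V. A v w * (x v * x w)))"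
    using assms by (intro sum.cong refl)
      (simp add: sum_inner_eq sum_distrib_left power2_eq_square algebra_simps)
  also have "\<dots> = (1 - \<alpha>) * (\<Sum>v\<in>V. (x v)\<^sup>2) - 2 * \<alpha> * quad x"
    by (simp add: quad_def sum_subtractf sum_distrib_left)
  finally show ?thesis using alpha_pos by (simp add: lam_def field_simps)
qed

text \<open>Subtracting the mean \<open>c\<close> reduces to sum zero. Restoring it costs a term
  linear in \<open>c\<close>, bounded through the degrees, and a quadratic term of favourable sign.
  The error is small when \<open>x\<close> lives on few of the \<open>n\<close> vertices.\<close>

lemma quad_le:
  assumes D: "\<And>v. v \<in> V \<Longrightarrow> deg v \<le> D"
  shows "quad x \<le> lam * (\<Sum>v\<in>V. (x v)\<^sup>2) + 2 * D * (\<Sum>v\<in>V. \<bar>x v\<bar>)\<^sup>2 / n"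
proof -
  define S where "S = (\<Sum>v\<in>V. \<bar>x v\<bar>)"
  define c where "c = (\<Sum>v\<in>V. x v) / n"
  define y where "y v = x v - c" for v
  have S0: "S \<ge> 0" by (simp add: S_def sum_nonneg)
  have D0: "D \<ge> 0" using V_ne D deg_nonneg order_trans by blast
  have cn: "c * n = (\<Sum>v\<in>V. x v)" using n_pos by (simp add: c_def)
  have "(\<Sum>v\<in>V. y v) = 0" using cn by (simp add: y_def sum_subtractf mult.commute)
  then have 1: "quad y \<le> lam * (\<Sum>v\<in>V. (y v)\<^sup>2)" by (rule quad_le_of_sum_zero)
  have "(\<Sum>v\<in>V. (y v)\<^sup>2) = (\<Sum>v\<in>V. (x v)\<^sup>2) - 2 * c * (\<Sum>v\<in>V. x v) + n * c\<^sup>2"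
  proof -
    have "(\<Sum>v\<in>V. (y v)\<^sup>2) = (\<Sum>v\<in>V. (x v)\<^sup>2 - 2 * c * x v + c\<^sup>2)"
      by (intro sum.cong refl) (simp add: y_def power2_diff algebra_simps)
    then show ?thesis by (simp add: sum.distrib sum_subtractf sum_distrib_left)
  qed
  also have "\<dots> = (\<Sum>v\<in>V. (x v)\<^sup>2) - n * c\<^sup>2"
    by (simp add: cn[symmetric] power2_eq_square algebra_simps)
  also have "\<dots> \<le> (\<Sum>v\<in>V. (x v)\<^sup>2)" by simp
  finally have 2: "lam * (\<Sum>v\<in>V. (y v)\<^sup>2) \<le> lam * (\<Sum>v\<in>V. (x v)\<^sup>2)"
    using lam_pos by simp
  have d1: "(\<Sum>v\<in>V. \<Sum>w\<in>V. A v w * x v) = (\<Sum>v\<in>V. deg v * x v)"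
    by (simp add: deg_def sum_distrib_right)
  have d2: "(\<Sum>v\<in>V. \<Sum>w\<in>V. A v w * x w) = (\<Sum>v\<in>V. deg v * x v)"
    by (subst sum.swap) (simp add: deg_def sum_distrib_right A_commute)
  have "quad y = (\<Sum>v\<in>V. \<Sum>w\<in>V. A v w * (x v * x w) - c * (A v w * x v) - c * (A v w * x w) + c\<^sup>2 * A v w)"
    unfolding quad_def y_def by (intro sum.cong refl) (simp add: algebra_simps power2_eq_square)
  also have "\<dots> = quad x - 2 * c * (\<Sum>v\<in>V. deg v * x v) + c\<^sup>2 * (\<Sum>v\<in>V. deg v)"
    using d1 d2 by (simp add: sum.distrib sum_subtractf sum_distrib_left[symmetric] quad_def deg_def)
  finally have 3: "quad x = quad y + 2 * c * (\<Sum>v\<in>V. deg v * x v) - c\<^sup>2 * (\<Sum>v\<in>V. deg v)" by simp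
  have "\<bar>\<Sum>v\<in>V. deg v * x v\<bar> \<le> (\<Sum>v\<in>V. D * \<bar>x v\<bar>)"
    by (intro order_trans[OF sum_abs] sum_mono)
       (simp add: abs_mult deg_nonneg D mult_right_mono)
  then have 4: "\<bar>\<Sum>v\<in>V. deg v * x v\<bar> \<le> D * S" by (simp add: S_def sum_distrib_left)
  have 5: "\<bar>c\<bar> \<le> S / n"
    using n_pos by (simp add: c_def S_def abs_div_pos[symmetric] divide_right_mono)
  have "2 * c * (\<Sum>v\<in>V. deg v * x v) \<le> 2 * (\<bar>c\<bar> * \<bar>\<Sum>v\<in>V. deg v * x v\<bar>)"
    by (metis abs_ge_self abs_mult mult.assoc mult_left_mono zero_le_numeral)
  also have "\<dots> \<le> 2 * (S / n * (D * S))"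
    using 4 5 S0 n_pos D0 by (intro mult_left_mono mult_mono) auto
  finally have "2 * c * (\<Sum>v\<in>V. deg v * x v) \<le> 2 * D * S\<^sup>2 / n"
    by (simp add: power2_eq_square algebra_simps)
  moreover have "0 \<le> c\<^sup>2 * (\<Sum>v\<in>V. deg v)"
    by (simp add: deg_nonneg sum_nonneg)
  ultimately show ?thesis using 1 2 3 by (simp add: S_def)
qed

text \<open>A star with \<open>d\<close> leaves has largest eigenvalue \<open>sqrt d\<close>, so up
  to the error of \<open>quad_le\<close> the degree cannot exceed \<open>lam\<^sup>2\<close>. The
  test vector is a weighted star at a vertex of maximal degree.\<close>

lemma star_inequality:
  assumes v: "v \<in> V" and D: "\<And>w. w \<in> V \<Longrightarrow> deg w \<le> deg v"
  shows "deg v \<le> lam\<^sup>2 + 2 * (deg v)\<^sup>2 * (1 + lam)\<^sup>2 / (lam * n)"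
proof (cases "deg v = 0")
  case False
  define d where "d = deg v"
  have d: "d > 0" using False deg_nonneg[of v] by (simp add: d_def)
  \<comment> \<open>This weight of the centre maximises
    \<open>2 * a * d - lam * a\<^sup>2\<close>.\<close>
  define a where "a = d / lam"
  have a: "a > 0" using d lam_pos by (simp add: a_def)
  define x where "x w = (if w = v then a else 0) + A v w" for w
  have x0: "x w \<ge> 0" for w using a by (simp add: x_def A_nonneg)
  have Av: "A v v = 0" by (rule A_self[OF v])
  have "(\<Sum>w\<in>V. \<bar>x w\<bar>) = (\<Sum>w\<in>V. x w)" using x0 by simp
  also have "\<dots> = a + d" using v finite_V by (simp add: x_def sum.distrib d_def deg_def)
  finally have s1: "(\<Sum>w\<in>V. \<bar>x w\<bar>) = a + d" .
  have "(\<Sum>w\<in>V. (x w)\<^sup>2) = (\<Sum>w\<in>V. (if w = v then a\<^sup>2 else 0) + A v w)"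
    using Av by (intro sum.cong refl) (auto simp: x_def power2_eq_square A_sq)
  also have "\<dots> = a\<^sup>2 + d" using v finite_V by (simp add: sum.distrib d_def deg_def)
  finally have s2: "(\<Sum>w\<in>V. (x w)\<^sup>2) = a\<^sup>2 + d" .
  have nb: "a * A v w \<le> (\<Sum>w'\<in>V. A w w' * (x w * x w'))" if "w \<in> V" "w \<noteq> v" for w
  proof -
    have "a * A v w = A w v * (A v w * a)" using A_sq[of v w] by (simp add: A_commute[of w v])
    also have "\<dots> \<le> A w v * (x w * x v)"
      using that Av A_nonneg by (intro mult_left_mono) (auto simp: x_def)
    also have "\<dots> \<le> (\<Sum>w'\<in>V. A w w' * (x w * x w'))"
      using v finite_V x0 A_nonneg by (intro member_le_sum) auto
    finally show ?thesis .
  qed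
  \<comment> \<open>Each edge at the centre is seen once from the row of \<open>v\<close> and once
    from the row of its other end. Edges between neighbours only add nonnegative terms.\<close>
  have "2 * a * d = a * d + (\<Sum>w\<in>V - {v}. a * A v w)"
    using v finite_V Av by (simp add: d_def deg_def sum_distrib_left sum.remove[of V v] mult.assoc)
  also have "\<dots> \<le> (\<Sum>w'\<in>V. A v w' * (x v * x w')) + (\<Sum>w\<in>V - {v}. \<Sum>w'\<in>V. A w w' * (x w * x w'))"
  proof (intro add_mono sum_mono)
    have "a * d = (\<Sum>w'\<in>V. A v w' * (a * A v w'))"
      unfolding d_def deg_def sum_distrib_left
      by (intro sum.cong refl) (metis A_sq mult.left_commute)
    also have "\<dots> \<le> (\<Sum>w'\<in>V. A v w' * (x v * x w'))"
      using a Av A_nonneg by (intro sum_mono mult_left_mono) (auto simp: x_def)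
    finally show "a * d \<le> (\<Sum>w'\<in>V. A v w' * (x v * x w'))" .
  qed (use nb in auto)
  also have "\<dots> = quad x"
    unfolding quad_def using v finite_V by (subst sum.remove[of V v]) auto
  also have "\<dots> \<le> lam * (a\<^sup>2 + d) + 2 * d * (a + d)\<^sup>2 / n"
    using quad_le[of d x] D by (simp add: s1 s2 d_def)
  finally have *: "2 * a * d \<le> lam * (a\<^sup>2 + d) + 2 * d * (a + d)\<^sup>2 / n" .
  have ad: "a + d = d * (1 + lam) / lam" using lam_pos by (simp add: a_def field_simps)
  have al: "lam * a = d" using lam_pos by (simp add: a_def)
  have "2 * a * d - lam * a\<^sup>2 = a * d"
    using al by (simp add: power2_eq_square algebra_simps)
  then have "a * d \<le> lam * d + 2 * d * (a + d)\<^sup>2 / n"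
    using * by (simp add: algebra_simps)
  then have "d * a \<le> d * (lam + 2 * (a + d)\<^sup>2 / n)" by (simp add: algebra_simps)
  then have "a \<le> lam + 2 * (a + d)\<^sup>2 / n" using d by simp
  then have "lam * a \<le> lam * (lam + 2 * (a + d)\<^sup>2 / n)" using lam_pos by simp
  also have "\<dots> = lam\<^sup>2 + 2 * d\<^sup>2 * (1 + lam)\<^sup>2 / (lam * n)"
    unfolding ad using lam_pos n_pos by (simp add: power2_eq_square field_simps)
  finally show ?thesis by (simp add: al d_def)
qed simp

text \<open>Test \<open>quad_le\<close> on the indicator of the two ends of an edge. If
  \<open>lam\<close> is well below 1, this rules out edges altogether.\<close>

lemma edge_inequality:
  assumes "v \<in> V" "w \<in> V" "A v w \<noteq> 0" and D: "\<And>w. w \<in> V \<Longrightarrow> deg w \<le> D"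
  shows "1 \<le> lam + 4 * D / n"
proof -
  define x where "x z = (if z = v then 1 else 0) + (if z = w then (1::real) else 0)" for z
  have A1: "A v w = 1" "A w v = 1" using assms by (auto simp: A_def inner_commute split: if_splits)
  have vw: "v \<noteq> w" using assms A_self by auto
  have s1: "(\<Sum>z\<in>V. \<bar>x z\<bar>) = 2"
    using assms finite_V by (simp add: x_def sum.distrib)
  have "(\<Sum>z\<in>V. (x z)\<^sup>2) = (\<Sum>z\<in>V. x z)"
    using vw by (intro sum.cong refl) (auto simp: x_def)
  then have s2: "(\<Sum>z\<in>V. (x z)\<^sup>2) = 2" using assms finite_V by (simp add: x_def sum.distrib)
  have "quad x = 2"
    using assms finite_V A1 vw A_self
    by (simp add: quad_def x_def algebra_simps sum.distrib if_distrib[of "(*) _"] cong: if_cong)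
  then show ?thesis using quad_le[of D x] D by (simp add: s1 s2)
qed

end

section \<open>Degree bounds\<close>

text \<open>Maximality is exploited in two ways: against flipping one vector, which makes all inner
  products with the sum at least 1, and against the signs seen from one vector, which makes the sum
  long.\<close>

locale oriented_equiangular_vectors = equiangular_vectors V \<alpha>
  for V :: "(real ^ 'n) set" and \<alpha> +
  assumes maximal: "(\<And>v. v \<in> V \<Longrightarrow> s v = 1 \<or> s v = -1) \<Longrightarrow>
    norm (\<Sum>v\<in>V. s v *\<^sub>R v) \<le> norm (\<Sum>v\<in>V. v)"
begin

definition G :: real where
  "G = (norm (\<Sum>v\<in>V. v))\<^sup>2"

lemma inner_sum_V:
  assumes "v \<in> V"
  shows "(\<Sum>w\<in>V. w) \<bullet> v = 1 - \<alpha> + \<alpha> * n - 2 * \<alpha> * deg v"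
proof -
  have "(\<Sum>w\<in>V. w) \<bullet> v = (\<Sum>w\<in>V. 1 * (v \<bullet> w))"
    by (subst inner_sum_left) (simp add: inner_commute)
  then show ?thesis using sum_inner_eq[of v V "\<lambda>_. 1"] assms by (simp add: deg_def)
qed

text \<open>Flipping \<open>v\<close> changes the squared norm of the sum \<open>u\<close> by
  \<open>4 - 4 * (u \<bullet> v)\<close>, which cannot be positive.\<close>

lemma inner_sum_V_ge_1:
  assumes "v \<in> V"
  shows "(\<Sum>w\<in>V. w) \<bullet> v \<ge> 1"
proof -
  define u where "u = (\<Sum>w\<in>V. w)"
  have "(\<Sum>w\<in>V. (if w = v then -1 else 1) *\<^sub>R w) = (\<Sum>w\<in>V. w - (if w = v then 2 *\<^sub>R w else 0))"
    by (intro sum.cong refl) (auto simp: scaleR_2)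
  also have "\<dots> = u - 2 *\<^sub>R v"
    using assms finite_V by (simp add: sum_subtractf u_def)
  finally have "norm (u - 2 *\<^sub>R v) \<le> norm u"
    using maximal[of "\<lambda>w. if w = v then -1 else 1"] by (simp add: u_def)
  then have "(norm (u - 2 *\<^sub>R v))\<^sup>2 \<le> (norm u)\<^sup>2" by (simp add: power_mono)
  then show ?thesis
    using unit[OF assms] unfolding power2_norm_eq_inner u_def[symmetric]
    by (simp add: inner_diff_left inner_diff_right inner_commute)
qed

lemma G_eq_sum: "G = (\<Sum>v\<in>V. (\<Sum>w\<in>V. w) \<bullet> v)"
  by (simp add: G_def power2_norm_eq_inner inner_sum_right)

lemma G_pos: "G > 0"
proof -
  have "(\<Sum>v\<in>V. 1) \<le> G" unfolding G_eq_sum using inner_sum_V_ge_1 by (intro sum_mono) auto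
  then show ?thesis using n_pos by simp
qed

text \<open>Orient all vectors so that their inner products with a fixed \<open>v\<close> are
  positive. The resulting sum has inner product at least \<open>\<alpha> * n\<close> with the unit
  vector \<open>v\<close>, and the maximal sum is no shorter.\<close>

lemma G_ge_sq: "G \<ge> \<alpha>\<^sup>2 * n\<^sup>2"
proof -
  obtain v where v: "v \<in> V" using V_ne by blast
  define s :: "real ^ 'n \<Rightarrow> real" where "s w = (if v \<bullet> w < 0 then -1 else 1)" for w
  define u where "u = (\<Sum>w\<in>V. s w *\<^sub>R w)"
  have "\<alpha> * n = (\<Sum>w\<in>V. \<alpha>)" by simp
  also have "\<dots> \<le> (\<Sum>w\<in>V. s w * (v \<bullet> w))"
  proof (rule sum_mono)
    fix w assume "w \<in> V"
    then show "\<alpha> \<le> s w * (v \<bullet> w)"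
      using unit[OF v] angle[OF v, of w] alpha_less_1 by (cases "w = v") (auto simp: s_def)
  qed
  also have "\<dots> = v \<bullet> u" by (simp add: u_def inner_sum_right)
  also have "\<dots> \<le> norm v * norm u" by (rule norm_cauchy_schwarz)
  also have "norm v = 1" using unit[OF v] by (simp add: norm_eq_sqrt_inner)
  also have "1 * norm u \<le> norm (\<Sum>w\<in>V. w)"
    using maximal[of s] by (simp add: u_def s_def)
  finally have "(\<alpha> * n)\<^sup>2 \<le> (norm (\<Sum>w\<in>V. w))\<^sup>2"
    using alpha_pos by (intro power_mono) auto
  then show ?thesis by (simp add: G_def power_mult_distrib)
qed

lemma G_ge_of_deg_le:
  assumes "\<And>v. v \<in> V \<Longrightarrow> deg v \<le> D"
  shows "G \<ge> \<alpha> * n\<^sup>2 - 2 * \<alpha> * n * D"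
proof -
  have "\<alpha> * n\<^sup>2 - 2 * \<alpha> * n * D = (\<Sum>v\<in>V. \<alpha> * n - 2 * \<alpha> * D)"
    by (simp add: power2_eq_square algebra_simps)
  also have "\<dots> \<le> G"
    unfolding G_eq_sum
  proof (rule sum_mono)
    fix v assume v: "v \<in> V"
    have "2 * \<alpha> * deg v \<le> 2 * \<alpha> * D" using assms[OF v] alpha_pos by simp
    then show "\<alpha> * n - 2 * \<alpha> * D \<le> (\<Sum>w\<in>V. w) \<bullet> v"
      using inner_sum_V[OF v] alpha_less_1 by linarith
  qed
  finally show ?thesis .
qed

text \<open>Apply \<open>projection\<close> to \<open>v\<close>, the total sum \<open>u\<close> and
  a function \<open>h\<close> of sum zero whose sign agrees with that of
  \<open>v \<bullet> w\<close>. Every product \<open>(v \<bullet> w) * h w\<close> is then at least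
  \<open>\<alpha> * d\<close>, and its weight \<open>u \<bullet> w\<close> is positive, so the sum
  is at least \<open>\<alpha> * d * G\<close>.\<close>

lemma deg_mult_G_le:
  assumes v: "v \<in> V"
  shows "\<alpha>\<^sup>2 * deg v * G \<le> n\<^sup>2"
proof (cases "deg v = 0")
  case False
  define d where "d = deg v"
  define u where "u = (\<Sum>w\<in>V. w)"
  have d: "d > 0" using False deg_nonneg[of v] by (simp add: d_def)
  \<comment> \<open>By maximality at most half of the vectors are neighbours; this makes
    \<open>n - d\<close>, the size of \<open>h\<close> on neighbours, at least
    \<open>d\<close>.\<close>
  have d2: "2 * d \<le> n"
  proof -
    have "\<alpha> * (2 * d) \<le> \<alpha> * n"
      using inner_sum_V[OF v] inner_sum_V_ge_1[OF v] alpha_pos unfolding d_def by linarith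
    then show ?thesis using alpha_pos by simp
  qed
  define h where "h w = d - n * A v w" for w
  have h0: "(\<Sum>w\<in>V. h w) = 0"
    by (simp add: h_def sum_subtractf d_def deg_def flip: sum_distrib_left)
  have "(\<Sum>w\<in>V. (h w)\<^sup>2) = (\<Sum>w\<in>V. d\<^sup>2 + (n\<^sup>2 - 2 * d * n) * A v w)"
    by (intro sum.cong refl) (auto simp: h_def A_def power2_eq_square algebra_simps)
  also have "\<dots> = n * d\<^sup>2 + (n\<^sup>2 - 2 * d * n) * d"
    by (simp add: sum.distrib d_def deg_def flip: sum_distrib_left)
  also have "\<dots> = n\<^sup>2 * d - n * d\<^sup>2" by (simp add: power2_eq_square algebra_simps)
  also have "\<dots> \<le> n\<^sup>2 * d" by simp
  finally have h2: "(\<Sum>w\<in>V. (h w)\<^sup>2) \<le> n\<^sup>2 * d" .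
  have "\<alpha> * d * G = (\<Sum>w\<in>V. \<alpha> * d * (u \<bullet> w))"
    by (simp add: G_eq_sum u_def sum_distrib_left)
  also have "\<dots> \<le> (\<Sum>w\<in>V. (v \<bullet> w) * (u \<bullet> w) * h w)"
  proof (rule sum_mono)
    fix w assume w: "w \<in> V"
    have g: "u \<bullet> w \<ge> 1" using inner_sum_V_ge_1[OF w] by (simp add: u_def)
    have "\<alpha> * d \<le> (v \<bullet> w) * h w"
    proof (cases "v \<bullet> w < 0")
      case True
      then have "v \<bullet> w = -\<alpha>" using angle[OF v w] unit[OF v] by force
      moreover have "\<alpha> * d \<le> \<alpha> * (n - d)" using d2 alpha_pos by (intro mult_left_mono) auto
      ultimately show ?thesis using True by (simp add: h_def A_def algebra_simps)
    next
      case False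
      then have "v \<bullet> w \<ge> \<alpha>" using angle[OF v w] unit[OF v] alpha_less_1 by force
      then show ?thesis using False d by (simp add: h_def A_def mult_right_mono)
    qed
    then have "(\<alpha> * d) * (u \<bullet> w) \<le> ((v \<bullet> w) * h w) * (u \<bullet> w)"
      using g by (intro mult_right_mono) auto
    then show "\<alpha> * d * (u \<bullet> w) \<le> (v \<bullet> w) * (u \<bullet> w) * h w" by (simp add: algebra_simps)
  qed
  finally have "(\<alpha> * d * G)\<^sup>2 \<le> (\<Sum>w\<in>V. (v \<bullet> w) * (u \<bullet> w) * h w)\<^sup>2"
    using alpha_pos d G_pos by (intro power_mono) auto
  also have "\<dots> \<le> (norm v)\<^sup>2 * (norm u)\<^sup>2 * (\<Sum>w\<in>V. (h w)\<^sup>2)"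
    by (rule projection[OF h0])
  also have "\<dots> = G * (\<Sum>w\<in>V. (h w)\<^sup>2)"
    using unit[OF v] by (simp add: power2_norm_eq_inner G_def u_def)
  also have "\<dots> \<le> G * (n\<^sup>2 * d)"
    using h2 G_pos by simp
  finally have "(G * d) * (\<alpha>\<^sup>2 * d * G) \<le> (G * d) * n\<^sup>2"
    by (simp add: power2_eq_square algebra_simps)
  then show ?thesis using d G_pos by (simp add: d_def)
qed simp

text \<open>Bootstrap: a lower bound for \<open>G\<close> bounds the degrees by
  \<open>deg_mult_G_le\<close>, and bounded degrees improve the lower bound for \<open>G\<close>.
  Starting from \<open>G_ge_sq\<close>, the constant \<open>c\<close> in
  \<open>G \<ge> \<alpha> * n\<^sup>2 * c\<close> passes from \<open>\<alpha>\<close> over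
  \<open>1 - 2 / \<nu>\<close> to \<open>7 / 8\<close>.\<close>

lemma deg_le_cube:
  assumes N: "n * \<alpha> ^ 4 \<ge> 2 + 16 * \<alpha>" and v: "v \<in> V"
  shows "deg v \<le> 8 / 7 / \<alpha> ^ 3"
proof -
  define \<nu> where "\<nu> = n * \<alpha> ^ 4"
  have nu: "\<nu> \<ge> 2 + 16 * \<alpha>" "\<nu> > 2" using N alpha_pos by (auto simp: \<nu>_def)
  have nn: "n = \<nu> / \<alpha> ^ 4" using alpha_pos by (simp add: \<nu>_def)
  have step: "deg w \<le> 1 / (\<alpha> ^ 3 * c)" if "c > 0" "G \<ge> \<alpha> * n\<^sup>2 * c" "w \<in> V" for c w
  proof -
    have "\<alpha>\<^sup>2 * deg w * (\<alpha> * n\<^sup>2 * c) \<le> \<alpha>\<^sup>2 * deg w * G"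
      using that deg_nonneg by (intro mult_left_mono) auto
    also have "\<dots> \<le> n\<^sup>2" by (rule deg_mult_G_le[OF that(3)])
    finally have "n\<^sup>2 * (\<alpha> ^ 3 * c * deg w) \<le> n\<^sup>2 * 1"
      by (simp add: power2_eq_square power3_eq_cube algebra_simps)
    then have "\<alpha> ^ 3 * c * deg w \<le> 1"
      using n_pos by (subst (asm) mult_le_cancel_left_pos) auto
    then show ?thesis using that alpha_pos by (simp add: field_simps)
  qed
  have d1: "deg w \<le> 1 / (\<alpha> ^ 3 * \<alpha>)" if "w \<in> V" for w
    using G_ge_sq alpha_pos that by (intro step) (auto simp: power2_eq_square algebra_simps)
  define c where "c = 1 - 2 / \<nu>"
  have c: "c > 0" using nu by (simp add: c_def)
  have "\<alpha> * n\<^sup>2 * c = \<alpha> * n\<^sup>2 - 2 * \<alpha> * n * (1 / (\<alpha> ^ 3 * \<alpha>))"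
    using alpha_pos nu by (simp add: c_def nn field_simps power2_eq_square power3_eq_cube power4_eq_xxxx)
  also have "\<dots> \<le> G" by (rule G_ge_of_deg_le[OF d1])
  finally have d2: "deg w \<le> 1 / (\<alpha> ^ 3 * c)" if "w \<in> V" for w
    using step[OF c _ that] by simp
  have "2 * \<alpha> / (\<nu> * c) \<le> 1 / 8"
  proof -
    have "\<nu> * c = \<nu> - 2" using nu by (simp add: c_def field_simps)
    then show ?thesis using nu by (simp add: field_simps)
  qed
  then have "\<alpha> * n\<^sup>2 * (7 / 8) \<le> \<alpha> * n\<^sup>2 * (1 - 2 * \<alpha> / (\<nu> * c))"
    using alpha_pos by (intro mult_left_mono) auto
  also have "\<dots> = \<alpha> * n\<^sup>2 - 2 * \<alpha> * n * (1 / (\<alpha> ^ 3 * c))"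
    using alpha_pos nu c by (simp add: nn field_simps power2_eq_square power3_eq_cube power4_eq_xxxx)
  also have "\<dots> \<le> G" by (rule G_ge_of_deg_le[OF d2])
  finally show ?thesis using step[of "7/8" v] v by simp
qed

text \<open>Here \<open>lam \<le> 1 / 2\<close>, and the error in \<open>edge_inequality\<close> is
  at most 32/70 < 1/2, so no edge can exist.\<close>

lemma deg_eq_0:
  assumes "\<alpha> \<ge> 1 / 2" "n * \<alpha> ^ 4 \<ge> 10" "n * \<alpha> ^ 4 \<ge> 2 + 16 * \<alpha>" "v \<in> V"
  shows "deg v = 0"
proof (rule ccontr)
  assume "deg v \<noteq> 0"
  then obtain w where w: "w \<in> V" "A v w \<noteq> 0"
    unfolding deg_def by (meson sum.not_neutral_contains_not_neutral)
  have "deg z \<le> 8 / 7 / \<alpha> ^ 3" if "z \<in> V" for z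
    using assms alpha_less_1 that by (intro deg_le_cube) auto
  then have 1: "1 \<le> lam + 4 * (8 / 7 / \<alpha> ^ 3) / n"
    using edge_inequality[OF assms(4) w, of "8 / 7 / \<alpha> ^ 3"] by blast
  have "n * \<alpha> ^ 4 = n * \<alpha> ^ 3 * \<alpha>" by (simp add: eval_nat_numeral)
  also have "\<dots> \<le> n * \<alpha> ^ 3 * 1"
    using alpha_pos alpha_less_1 n_pos by (intro mult_left_mono) auto
  finally have 2: "n * \<alpha> ^ 3 \<ge> 10" using assms by simp
  have "4 * (8 / 7 / \<alpha> ^ 3) / n = 32 / 7 / (n * \<alpha> ^ 3)" by simp
  also have "\<dots> \<le> 32 / 7 / 10" using 2 by (intro divide_left_mono) auto
  finally have 3: "4 * (8 / 7 / \<alpha> ^ 3) / n \<le> 32 / 7 / 10" .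
  have "lam \<le> 1 / 2" using assms alpha_pos by (simp add: lam_def field_simps)
  with 1 3 show False by linarith
qed

text \<open>Inserting the cubic bound for one factor of the quadratic error in the star inequality
  gives \<open>d \<le> lam\<^sup>2 + d * q\<close>. The claim follows from
  \<open>q \<le> 5 / 11\<close>.\<close>

lemma deg_le_lam_sq:
  assumes small: "\<alpha> < 1 / 2" and N: "n * \<alpha> ^ 4 \<ge> 3" "n * \<alpha> ^ 4 \<ge> 1 + 34 * \<alpha>" and w: "w \<in> V"
  shows "deg w \<le> 11 / 6 * lam\<^sup>2"
proof -
  define \<nu> where "\<nu> = n * \<alpha> ^ 4"
  have nu: "\<nu> \<ge> 3" "\<nu> \<ge> 1 + 34 * \<alpha>" using N by (auto simp: \<nu>_def)
  have nn: "n = \<nu> / \<alpha> ^ 4" using alpha_pos by (simp add: \<nu>_def)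
  have cube: "deg v \<le> 8 / 7 / \<alpha> ^ 3" if "v \<in> V" for v
    using N that by (intro deg_le_cube) linarith+
  have "Max (deg ` V) \<in> deg ` V" using finite_V V_ne by (intro Max_in) auto
  then obtain v where v: "v \<in> V" "deg v = Max (deg ` V)" by auto
  then have vmax: "deg z \<le> deg v" if "z \<in> V" for z using finite_V that by simp
  define d where "d = deg v"
  have d0: "d \<ge> 0" by (simp add: d_def deg_nonneg)
  define q where "q = 8 / 7 * (1 + \<alpha>)\<^sup>2 / ((1 - \<alpha>) * \<nu>)"
  have L: "(1 + lam)\<^sup>2 / lam = (1 + \<alpha>)\<^sup>2 / (2 * \<alpha> * (1 - \<alpha>))"
  proof -
    have "1 + lam = (1 + \<alpha>) / (2 * \<alpha>)" using alpha_pos by (simp add: lam_def field_simps)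
    then show ?thesis using alpha_pos alpha_less_1
      by (simp add: lam_def power2_eq_square field_simps)
  qed
  have "2 * d\<^sup>2 * (1 + lam)\<^sup>2 / (lam * n) = d * (2 * d / n * ((1 + lam)\<^sup>2 / lam))"
    using lam_pos n_pos by (simp add: power2_eq_square field_simps)
  also have "\<dots> \<le> d * (2 * (8 / 7 / \<alpha> ^ 3) / n * ((1 + lam)\<^sup>2 / lam))"
    using cube[OF v(1)] d0 n_pos lam_pos
    by (intro mult_left_mono mult_right_mono divide_right_mono) (auto simp: d_def)
  also have "2 * (8 / 7 / \<alpha> ^ 3) / n * ((1 + lam)\<^sup>2 / lam) = q"
    unfolding L q_def nn using alpha_pos alpha_less_1 nu
    by (simp add: power2_eq_square field_simps eval_nat_numeral)
  finally have star: "d \<le> lam\<^sup>2 + d * q"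
    using star_inequality[OF v(1) vmax] by (simp add: d_def)
  \<comment> \<open>This is \<open>q \<le> 5 / 11\<close> without denominators. The two lower bounds
    3 and \<open>1 + 34 * \<alpha>\<close> for \<open>\<nu>\<close> coincide at
    \<open>\<alpha> = 1 / 17\<close>, where the cases divide.\<close>
  have "88 * (1 + \<alpha>)\<^sup>2 \<le> 35 * (1 - \<alpha>) * \<nu>"
  proof (cases "\<alpha> \<le> 1 / 17")
    case True
    have "(1 + \<alpha>)\<^sup>2 \<le> 324 / 289"
      using power_mono[of "1 + \<alpha>" "18 / 17" 2] True alpha_pos by (simp add: power_divide)
    moreover have "(16 / 17) * 3 \<le> (1 - \<alpha>) * \<nu>" using True nu alpha_pos by (intro mult_mono) auto
    ultimately have "88 * (1 + \<alpha>)\<^sup>2 \<le> 35 * ((1 - \<alpha>) * \<nu>)"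
      by linarith
    then show ?thesis by (simp only: mult.assoc)
  next
    case False
    have "(1 - \<alpha>) * (1 + 34 * \<alpha>) \<le> (1 - \<alpha>) * \<nu>" using nu small by (intro mult_left_mono) auto
    moreover have "88 * (1 + \<alpha>)\<^sup>2 \<le> 35 * ((1 - \<alpha>) * (1 + 34 * \<alpha>))"
    proof -
      \<comment> \<open>The product bounds \<open>\<alpha>\<^sup>2\<close> by a linear expression on
        the interval from 1/17 to 1/2.\<close>
      have "0 \<le> (\<alpha> - 1 / 17) * (1 / 2 - \<alpha>)" using False small by (intro mult_nonneg_nonneg) auto
      also have "\<dots> = 19 / 34 * \<alpha> - 1 / 34 - \<alpha>\<^sup>2" by (simp add: power2_eq_square field_simps)
      finally have "1278 * \<alpha>\<^sup>2 - 979 * \<alpha> + 53 \<le> 0" using False by linarith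
      then show ?thesis by (simp add: power2_eq_square algebra_simps)
    qed
    ultimately have "88 * (1 + \<alpha>)\<^sup>2 \<le> 35 * ((1 - \<alpha>) * \<nu>)" by linarith
    then show ?thesis by (simp only: mult.assoc)
  qed
  then have "q \<le> 5 / 11" unfolding q_def using nu alpha_less_1 by (simp add: field_simps)
  then have "d * q \<le> d * (5 / 11)" using d0 by (intro mult_left_mono) auto
  then have "d \<le> 11 / 6 * lam\<^sup>2" using star by simp
  then show ?thesis using vmax[OF w] by (simp add: d_def)
qed

end

section \<open>Multiplicity of the eigenvalue\<close>

text \<open>Pythagoras: the coefficients \<open>b\<close> are those of the orthogonal projection of
  \<open>a\<close> to the span of \<open>F\<close>.\<close>

lemma sum_sq_residual:
  fixes F :: "('v \<Rightarrow> real) set"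
  assumes F: "finite F" "finite H"
    and on: "\<forall>f\<in>F. \<forall>f'\<in>F. (\<Sum>h\<in>H. f h * f' h) = (if f = f' then 1 else 0)"
    and b: "\<And>f. f \<in> F \<Longrightarrow> b f = (\<Sum>h\<in>H. a h * f h)"
  shows "(\<Sum>h\<in>H. (a h - (\<Sum>f\<in>F. b f * f h))\<^sup>2) = (\<Sum>h\<in>H. (a h)\<^sup>2) - (\<Sum>f\<in>F. (b f)\<^sup>2)"
proof -
  have cross: "(\<Sum>h\<in>H. a h * (\<Sum>f\<in>F. b f * f h)) = (\<Sum>f\<in>F. (b f)\<^sup>2)"
  proof -
    have "(\<Sum>h\<in>H. a h * (\<Sum>f\<in>F. b f * f h)) = (\<Sum>h\<in>H. \<Sum>f\<in>F. b f * (a h * f h))"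
      unfolding sum_distrib_left by (intro sum.cong refl) (simp add: mult.left_commute)
    also have "\<dots> = (\<Sum>f\<in>F. b f * (\<Sum>h\<in>H. a h * f h))"
      unfolding sum_distrib_left by (rule sum.swap)
    also have "\<dots> = (\<Sum>f\<in>F. (b f)\<^sup>2)"
      by (intro sum.cong refl) (simp only: b[symmetric] power2_eq_square)
    finally show ?thesis .
  qed
  have "(\<Sum>h\<in>H. (\<Sum>f\<in>F. b f * f h) * (\<Sum>f\<in>F. b f * f h)) =
      (\<Sum>h\<in>H. \<Sum>f\<in>F. \<Sum>f'\<in>F. b f * b f' * (f h * f' h))"
    unfolding sum_product by (intro sum.cong refl) (simp add: algebra_simps)
  also have "\<dots> = (\<Sum>f\<in>F. \<Sum>f'\<in>F. b f * b f' * (\<Sum>h\<in>H. f h * f' h))"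
    unfolding sum_distrib_left by (subst sum.swap, intro sum.cong refl, rule sum.swap)
  also have "\<dots> = (\<Sum>f\<in>F. \<Sum>f'\<in>F. if f = f' then b f * b f' else 0)"
    using on by (intro sum.cong refl) auto
  also have "\<dots> = (\<Sum>f\<in>F. (b f)\<^sup>2)"
    using F by (simp add: power2_eq_square)
  finally have sq: "(\<Sum>h\<in>H. (\<Sum>f\<in>F. b f * f h) * (\<Sum>f\<in>F. b f * f h)) = (\<Sum>f\<in>F. (b f)\<^sup>2)" .
  have "(\<Sum>h\<in>H. (a h - (\<Sum>f\<in>F. b f * f h))\<^sup>2) =
      (\<Sum>h\<in>H. (a h)\<^sup>2 - 2 * (a h * (\<Sum>f\<in>F. b f * f h)) + (\<Sum>f\<in>F. b f * f h) * (\<Sum>f\<in>F. b f * f h))"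
    by (intro sum.cong refl) (simp add: power2_eq_square algebra_simps)
  then show ?thesis
    by (simp add: sum.distrib sum_subtractf sq cross flip: sum_distrib_left)
qed

text \<open>With \<open>P\<close> the orthogonal projection to the span of \<open>F\<close>, the
  assumption \<open>eig\<close> says \<open>M (I - P) = \<mu> (I - P)\<close>. Comparing traces and
  Frobenius norms of both sides gives the two identities, since \<open>I - P\<close> has trace
  \<open>card H - card F\<close>.\<close>

lemma eigenspace_identities:
  fixes M :: "'v \<Rightarrow> 'v \<Rightarrow> real" and F :: "('v \<Rightarrow> real) set"
  assumes F: "finite F" "finite H"
    and on: "\<forall>f\<in>F. \<forall>f'\<in>F. (\<Sum>h\<in>H. f h * f' h) = (if f = f' then 1 else 0)"
    and eig: "\<And>x v. (\<forall>f\<in>F. (\<Sum>h\<in>H. x h * f h) = 0) \<Longrightarrow> v \<in> H \<Longrightarrow> (\<Sum>h\<in>H. M v h * x h) = \<mu> * x v"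
  shows eigenspace_trace: "(\<Sum>v\<in>H. M v v) - (\<Sum>f\<in>F. \<Sum>v\<in>H. f v * (\<Sum>h\<in>H. M v h * f h)) =
      \<mu> * (real (card H) - real (card F))"
    and eigenspace_norm: "(\<Sum>v\<in>H. \<Sum>w\<in>H. (M v w)\<^sup>2) - (\<Sum>f\<in>F. \<Sum>v\<in>H. (\<Sum>h\<in>H. M v h * f h)\<^sup>2) =
      \<mu>\<^sup>2 * (real (card H) - real (card F))"
proof -
  define Mf where "Mf f v = (\<Sum>h\<in>H. M v h * f h)" for f v
  have f2: "(\<Sum>v\<in>H. \<Sum>f\<in>F. f v * f v) = real (card F)"
    using on by (subst sum.swap) simp
  have key: "M v w - (\<Sum>f\<in>F. Mf f v * f w) = \<mu> * ((if v = w then 1 else 0) - (\<Sum>f\<in>F. f v * f w))"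
    if "v \<in> H" "w \<in> H" for v w
  proof -
    \<comment> \<open>Column \<open>w\<close> of \<open>I - P\<close>, which is orthogonal to
      \<open>F\<close>.\<close>
    define x where "x h = (if w = h then 1 else 0) - (\<Sum>f\<in>F. f w * f h)" for h
    have "(\<Sum>h\<in>H. x h * f h) = 0" if f: "f \<in> F" for f
    proof -
      have "(\<Sum>h\<in>H. (\<Sum>f'\<in>F. f' w * f' h) * f h) = (\<Sum>f'\<in>F. f' w * (\<Sum>h\<in>H. f' h * f h))"
        unfolding sum_distrib_left sum_distrib_right
        by (subst sum.swap) (simp add: mult.assoc)
      also have "\<dots> = (\<Sum>f'\<in>F. if f' = f then f' w else 0)"
        using on f by (intro sum.cong refl) auto
      also have "\<dots> = f w" using F f by simp
      finally have 1: "(\<Sum>h\<in>H. (\<Sum>f'\<in>F. f' w * f' h) * f h) = f w" .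
      have "(\<Sum>h\<in>H. x h * f h) = (\<Sum>h\<in>H. (if w = h then f h else 0) - (\<Sum>f'\<in>F. f' w * f' h) * f h)"
        by (intro sum.cong refl) (simp add: x_def left_diff_distrib)
      then show ?thesis using 1 F \<open>w \<in> H\<close> by (simp add: sum_subtractf)
    qed
    then have e: "(\<Sum>h\<in>H. M v h * x h) = \<mu> * x v" using eig that by blast
    have "(\<Sum>h\<in>H. M v h * (\<Sum>f\<in>F. f w * f h)) = (\<Sum>h\<in>H. \<Sum>f\<in>F. f w * (M v h * f h))"
      unfolding sum_distrib_left by (intro sum.cong refl) (simp add: mult.left_commute)
    also have "\<dots> = (\<Sum>f\<in>F. Mf f v * f w)"
      unfolding Mf_def sum_distrib_right by (subst sum.swap) (simp add: mult.commute)
    finally have 2: "(\<Sum>h\<in>H. M v h * (\<Sum>f\<in>F. f w * f h)) = (\<Sum>f\<in>F. Mf f v * f w)" .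
    have "(\<Sum>h\<in>H. M v h * x h) = (\<Sum>h\<in>H. (if w = h then M v h else 0) - M v h * (\<Sum>f\<in>F. f w * f h))"
      by (intro sum.cong refl) (simp add: x_def right_diff_distrib)
    then have "(\<Sum>h\<in>H. M v h * x h) = M v w - (\<Sum>f\<in>F. Mf f v * f w)"
      using 2 F \<open>w \<in> H\<close> by (simp add: sum_subtractf)
    then show ?thesis using e by (auto simp: x_def mult.commute)
  qed
  have "(\<Sum>v\<in>H. M v v) - (\<Sum>f\<in>F. \<Sum>v\<in>H. f v * Mf f v) = (\<Sum>v\<in>H. M v v - (\<Sum>f\<in>F. Mf f v * f v))"
    by (subst sum.swap) (simp add: sum_subtractf mult.commute)
  also have "\<dots> = (\<Sum>v\<in>H. \<mu> * (1 - (\<Sum>f\<in>F. f v * f v)))"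
    by (intro sum.cong refl) (simp add: key)
  also have "\<dots> = \<mu> * (real (card H) - real (card F))"
    by (simp add: sum_subtractf f2 flip: sum_distrib_left)
  finally show "(\<Sum>v\<in>H. M v v) - (\<Sum>f\<in>F. \<Sum>v\<in>H. f v * (\<Sum>h\<in>H. M v h * f h)) =
      \<mu> * (real (card H) - real (card F))" by (simp add: Mf_def)
  have row: "(\<Sum>w\<in>H. (M v w)\<^sup>2) - (\<Sum>f\<in>F. (Mf f v)\<^sup>2) = \<mu>\<^sup>2 * (1 - (\<Sum>f\<in>F. f v * f v))" if "v \<in> H" for v
  proof -
    have "(\<Sum>w\<in>H. (M v w)\<^sup>2) - (\<Sum>f\<in>F. (Mf f v)\<^sup>2) = (\<Sum>w\<in>H. (M v w - (\<Sum>f\<in>F. Mf f v * f w))\<^sup>2)"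
      by (rule sum_sq_residual[OF F on, symmetric]) (simp add: Mf_def)
    also have "\<dots> = (\<Sum>w\<in>H. \<mu>\<^sup>2 * ((if v = w then 1 else 0) - (\<Sum>f\<in>F. f v * f w))\<^sup>2)"
      using that by (intro sum.cong refl) (simp only: key power_mult_distrib)
    also have "\<dots> = \<mu>\<^sup>2 * ((\<Sum>w\<in>H. (if v = w then 1 else 0)\<^sup>2) - (\<Sum>f\<in>F. (f v)\<^sup>2))"
    proof -
      have "(\<Sum>w\<in>H. ((if v = w then 1 else 0) - (\<Sum>f\<in>F. f v * f w))\<^sup>2) =
          (\<Sum>w\<in>H. (if v = w then 1 else 0)\<^sup>2) - (\<Sum>f\<in>F. (f v)\<^sup>2)"
        using that F(2)
        by (intro sum_sq_residual[OF F on]) (simp add: if_distrib[of "\<lambda>x. x * _"] cong: if_cong)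
      then show ?thesis by (simp only: sum_distrib_left[symmetric])
    qed
    also have "(\<Sum>w\<in>H. (if v = w then 1 else 0 :: real)\<^sup>2) = (\<Sum>w\<in>H. if v = w then 1 else 0)"
      by (intro sum.cong) auto
    finally show ?thesis using that F by (simp add: power2_eq_square)
  qed
  have "(\<Sum>v\<in>H. \<Sum>w\<in>H. (M v w)\<^sup>2) - (\<Sum>f\<in>F. \<Sum>v\<in>H. (Mf f v)\<^sup>2) =
      (\<Sum>v\<in>H. (\<Sum>w\<in>H. (M v w)\<^sup>2) - (\<Sum>f\<in>F. (Mf f v)\<^sup>2))"
    by (subst sum.swap[of _ H F]) (simp add: sum_subtractf)
  also have "\<dots> = (\<Sum>v\<in>H. \<mu>\<^sup>2 * (1 - (\<Sum>f\<in>F. f v * f v)))"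
    by (intro sum.cong refl row)
  also have "\<dots> = \<mu>\<^sup>2 * (real (card H) - real (card F))"
    by (simp add: sum_subtractf f2 flip: sum_distrib_left)
  finally show "(\<Sum>v\<in>H. \<Sum>w\<in>H. (M v w)\<^sup>2) - (\<Sum>f\<in>F. \<Sum>v\<in>H. (\<Sum>h\<in>H. M v h * f h)\<^sup>2) =
      \<mu>\<^sup>2 * (real (card H) - real (card F))" by (simp add: Mf_def)
qed

context equiangular_vectors
begin

text \<open>A function on \<open>H\<close> orthogonal to all coordinate functions
  (\<open>Some i\<close>) and to the constant 1 (\<open>None\<close>) is a linear dependency of sum
  zero. The Gram rows then make it an eigenvector for \<open>lam\<close>, so the complement of the
  eigenspace has dimension at most one more than that of the space.\<close>

lemma eigenspace_basis:
  assumes "H \<subseteq> V"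
  obtains F where "finite F" "card F \<le> CARD('n) + 1"
    "\<forall>f\<in>F. \<forall>f'\<in>F. (\<Sum>h\<in>H. f h * f' h) = (if f = f' then 1 else 0)"
    "\<And>x v. (\<forall>f\<in>F. (\<Sum>h\<in>H. x h * f h) = 0) \<Longrightarrow> v \<in> H \<Longrightarrow> (\<Sum>h\<in>H. A v h * x h) = lam * x v"
proof -
  have fH: "finite H" using assms finite_V finite_subset by blast
  define g :: "'n option \<Rightarrow> real ^ 'n \<Rightarrow> real"
    where "g j h = (case j of None \<Rightarrow> 1 | Some i \<Rightarrow> h $ i)" for j h
  obtain F where F: "finite F" "card F \<le> card (UNIV :: 'n option set)"
    "\<forall>f\<in>F. \<forall>f'\<in>F. (\<Sum>h\<in>H. f h * f' h) = (if f = f' then 1 else 0)"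
    and sp: "\<forall>x. (\<forall>f\<in>F. (\<Sum>h\<in>H. x h * f h) = 0) \<longrightarrow> (\<forall>i\<in>UNIV. (\<Sum>h\<in>H. x h * g i h) = 0)"
    using orthonormal_basis_on[OF finite_class.finite_UNIV fH, of g] by (elim exE conjE)
  show thesis
  proof (rule that[OF F(1) _ F(3)])
    show "card F \<le> CARD('n) + 1" using F(2) by (simp add: card_UNIV_option)
    fix x :: "real ^ 'n \<Rightarrow> real" and v
    assume "\<forall>f\<in>F. (\<Sum>h\<in>H. x h * f h) = 0" and v: "v \<in> H"
    then have z: "(\<Sum>h\<in>H. x h * g i h) = 0" for i using sp by blast
    have s0: "(\<Sum>h\<in>H. x h) = 0" using z[of None] by (simp add: g_def)
    have "(\<Sum>h\<in>H. x h *\<^sub>R h) = 0"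
      using z[of "Some i" for i] by (simp add: vec_eq_iff g_def)
    then have "v \<bullet> (\<Sum>h\<in>H. x h *\<^sub>R h) = 0" by simp
    then have "(\<Sum>h\<in>H. x h * (v \<bullet> h)) = 0" by (simp add: inner_sum_right)
    then have "2 * \<alpha> * (\<Sum>h\<in>H. A v h * x h) = (1 - \<alpha>) * x v"
      using sum_inner_eq[of v H x] assms v s0 by auto
    then show "(\<Sum>h\<in>H. A v h * x h) = lam * x v"
      using alpha_pos by (simp add: lam_def field_simps)
  qed
qed

text \<open>The trace of \<open>A\<close> is zero, so the diagonal values \<open>y f\<close> on
  \<open>F\<close> must compensate the eigenvalue \<open>lam\<close> on the complement. The
  Frobenius norm of \<open>A\<close> is limited by the degrees, and Cauchy-Schwarz over
  \<open>F\<close> shows that \<open>F\<close> cannot be small.\<close>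

lemma card_le_of_deg_le:
  assumes D: "\<And>v. v \<in> V \<Longrightarrow> deg v \<le> D"
  shows "n * lam\<^sup>2 \<le> (real CARD('n) + 1) * (lam\<^sup>2 + D)"
proof -
  have D0: "D \<ge> 0" using V_ne D deg_nonneg order_trans by blast
  obtain F where F: "finite F" "card F \<le> CARD('n) + 1"
    "\<forall>f\<in>F. \<forall>f'\<in>F. (\<Sum>h\<in>V. f h * f' h) = (if f = f' then 1 else 0)"
    and eig: "\<And>x v. (\<forall>f\<in>F. (\<Sum>h\<in>V. x h * f h) = 0) \<Longrightarrow> v \<in> V \<Longrightarrow> (\<Sum>h\<in>V. A v h * x h) = lam * x v"
    using eigenspace_basis[of V] by blast
  define t where "t = real (card F)"
  define y where "y f = (\<Sum>v\<in>V. f v * (\<Sum>h\<in>V. A v h * f h))" for f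
  define N where "N f = (\<Sum>v\<in>V. (\<Sum>h\<in>V. A v h * f h)\<^sup>2)" for f
  have "(\<Sum>v\<in>V. A v v) - (\<Sum>f\<in>F. y f) = lam * (n - t)"
    unfolding t_def y_def by (rule eigenspace_trace[OF F(1) finite_V F(3) eig])
  then have tr: "(\<Sum>f\<in>F. y f) = - (lam * (n - t))" by (simp add: A_self)
  have "(\<Sum>v\<in>V. \<Sum>w\<in>V. (A v w)\<^sup>2) - (\<Sum>f\<in>F. N f) = lam\<^sup>2 * (n - t)"
    unfolding t_def N_def by (rule eigenspace_norm[OF F(1) finite_V F(3) eig])
  moreover have "(\<Sum>v\<in>V. \<Sum>w\<in>V. (A v w)\<^sup>2) \<le> (\<Sum>v\<in>V. D)"
    using D by (intro sum_mono) (simp add: power2_eq_square A_sq deg_def)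
  ultimately have nm: "(\<Sum>f\<in>F. N f) \<le> n * D - lam\<^sup>2 * (n - t)" by simp
  have yN: "(y f)\<^sup>2 \<le> N f" if "f \<in> F" for f
  proof -
    have "(y f)\<^sup>2 \<le> (\<Sum>v\<in>V. (f v)\<^sup>2) * (\<Sum>v\<in>V. (\<Sum>h\<in>V. A v h * f h)\<^sup>2)"
      unfolding y_def by (rule Cauchy_Schwarz_ineq_sum)
    also have "(\<Sum>v\<in>V. (f v)\<^sup>2) = 1" using F(3) that by (simp add: power2_eq_square)
    finally show ?thesis by (simp add: N_def)
  qed
  have "(lam * (n - t))\<^sup>2 = (\<Sum>f\<in>F. 1 * y f)\<^sup>2" by (simp add: tr)
  also have "\<dots> \<le> (\<Sum>f\<in>F. 1\<^sup>2) * (\<Sum>f\<in>F. (y f)\<^sup>2)" by (rule Cauchy_Schwarz_ineq_sum)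
  also have "\<dots> \<le> t * (\<Sum>f\<in>F. N f)"
    using yN by (simp add: t_def sum_mono mult_left_mono)
  also have "\<dots> \<le> t * (n * D - lam\<^sup>2 * (n - t))"
    using nm by (intro mult_left_mono) (auto simp: t_def)
  finally have "n * (n * lam\<^sup>2) \<le> n * (t * (lam\<^sup>2 + D))"
    by (simp add: power2_eq_square algebra_simps)
  then have "n * lam\<^sup>2 \<le> t * (lam\<^sup>2 + D)" using n_pos by simp
  also have "\<dots> \<le> (real CARD('n) + 1) * (lam\<^sup>2 + D)"
    using F(2) D0 by (intro mult_right_mono) (auto simp: t_def)
  finally show ?thesis .
qed

end

section \<open>Closed walks\<close>

text \<open>A walk is the list of its vertices: the number counts edges, so the list is longer by
  one. Only vertices after the first are drawn from \<open>H\<close>, hence the assumption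
  \<open>u \<in> H\<close> in later lemmas.\<close>

primrec walks :: "'a::real_inner set \<Rightarrow> nat \<Rightarrow> 'a \<Rightarrow> 'a \<Rightarrow> 'a list set" where
  "walks H 0 = (\<lambda>u w. if u = w then {[u]} else {})"
| "walks H (Suc l) = (\<lambda>u w. \<Union>x\<in>{x \<in> H. u \<bullet> x < 0}. (#) u ` walks H l x w)"

lemma hd_walk: "p \<in> walks H l u w \<Longrightarrow> p \<noteq> [] \<and> hd p = u"
  by (cases l) (auto split: if_splits)

lemma finite_walks: "finite H \<Longrightarrow> finite (walks H l u w)"
  by (induction l arbitrary: u) auto

lemma set_walk: "p \<in> walks H l u w \<Longrightarrow> u \<in> H \<Longrightarrow> set p \<subseteq> H"
proof (induction l arbitrary: u p)
  case (Suc l)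
  then obtain x q where "x \<in> H" "q \<in> walks H l x w" "p = u # q" by auto
  then show ?case using Suc.IH[of q x] Suc.prems by simp
qed (auto split: if_splits)

lemma walks_subset:
  "H \<subseteq> K \<Longrightarrow> u \<in> H \<Longrightarrow> walks H l u w = {p \<in> walks K l u w. set p \<subseteq> H}"
proof (induction l arbitrary: u)
  case (Suc l)
  have hd_in: "x \<in> H" if "q \<in> walks K l x w" "set q \<subseteq> H" for q x
    using hd_walk[OF that(1)] that(2) hd_in_set[of q] by blast
  show ?case
  proof (intro equalityI subsetI)
    fix p assume "p \<in> walks H (Suc l) u w"
    then obtain x q where x: "x \<in> H" "u \<bullet> x < 0" "q \<in> walks H l x w" "p = u # q" by auto
    then have "q \<in> walks K l x w" "set q \<subseteq> H" using Suc by auto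
    then show "p \<in> {p \<in> walks K (Suc l) u w. set p \<subseteq> H}" using x Suc.prems by auto
  next
    fix p assume p: "p \<in> {p \<in> walks K (Suc l) u w. set p \<subseteq> H}"
    then obtain x q where x: "u \<bullet> x < 0" "q \<in> walks K l x w" "p = u # q" by auto
    then have q: "set q \<subseteq> H" using p by simp
    then have "x \<in> H" using x(2) hd_in by blast
    then have "q \<in> walks H l x w" using Suc x(2) q by blast
    then show "p \<in> walks H (Suc l) u w" using x \<open>x \<in> H\<close> by auto
  qed
qed auto

context equiangular_vectors
begin

text \<open>For finite \<open>H\<close> and vertices in \<open>H\<close>, these are the entries of
  the \<open>l\<close>-th power of the adjacency matrix of the subgraph induced on
  \<open>H\<close>.\<close>

definition cw :: "(real ^ 'n) set \<Rightarrow> nat \<Rightarrow> real ^ 'n \<Rightarrow> real ^ 'n \<Rightarrow> real" where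
  "cw H l u w = real (card (walks H l u w))"

lemma cw_0: "cw H 0 u w = (if u = w then 1 else 0)"
  by (simp add: cw_def)

lemma cw_Suc:
  assumes "finite H"
  shows "cw H (Suc l) u w = (\<Sum>x\<in>H. A u x * cw H l x w)"
proof -
  have "card (walks H (Suc l) u w) = (\<Sum>x\<in>{x \<in> H. u \<bullet> x < 0}. card ((#) u ` walks H l x w))"
    unfolding walks.simps
  proof (rule card_UN_disjoint)
    show "\<forall>x\<in>{x \<in> H. u \<bullet> x < 0}. \<forall>y\<in>{x \<in> H. u \<bullet> x < 0}. x \<noteq> y \<longrightarrow>
        (#) u ` walks H l x w \<inter> (#) u ` walks H l y w = {}"
      using hd_walk by blast
  qed (use assms in \<open>auto simp: finite_walks\<close>)
  also have "\<dots> = (\<Sum>x\<in>{x \<in> H. u \<bullet> x < 0}. card (walks H l x w))"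
    by (simp add: card_image)
  finally have "cw H (Suc l) u w = (\<Sum>x\<in>{x \<in> H. u \<bullet> x < 0}. cw H l x w)"
    by (simp add: cw_def)
  also have "\<dots> = (\<Sum>x\<in>H. A u x * cw H l x w)"
    using assms by (simp add: A_def sum.inter_filter if_distrib[of "\<lambda>x. x * _"] cong: if_cong)
  finally show ?thesis .
qed

lemma cw_add:
  assumes "finite H" "u \<in> H"
  shows "cw H (a + b) u w = (\<Sum>x\<in>H. cw H a u x * cw H b x w)"
  using assms(2)
proof (induction a arbitrary: u)
  case 0
  then show ?case using assms(1) by (simp add: cw_0 if_distrib[of "\<lambda>x. x * _"] cong: if_cong)
next
  case (Suc a)
  have "cw H (Suc a + b) u w = (\<Sum>y\<in>H. A u y * (\<Sum>x\<in>H. cw H a y x * cw H b x w))"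
    using Suc assms(1) by (simp add: cw_Suc)
  also have "\<dots> = (\<Sum>x\<in>H. \<Sum>y\<in>H. A u y * cw H a y x * cw H b x w)"
    unfolding sum_distrib_left by (subst sum.swap) (simp add: mult.assoc)
  also have "\<dots> = (\<Sum>x\<in>H. cw H (Suc a) u x * cw H b x w)"
    by (simp add: cw_Suc[OF assms(1)] sum_distrib_right)
  finally show ?case .
qed

lemma cw_1: "finite H \<Longrightarrow> w \<in> H \<Longrightarrow> cw H (Suc 0) u w = A u w"
  by (simp add: cw_Suc cw_0 if_distrib[of "\<lambda>x. _ * x"] cong: if_cong)

lemma cw_Suc_right:
  assumes "finite H" "u \<in> H" "w \<in> H"
  shows "cw H (Suc l) u w = (\<Sum>x\<in>H. A w x * cw H l u x)"
  using cw_add[OF assms(1,2), of l "Suc 0" w] assms(1,3) by (simp add: cw_1 A_commute mult.commute)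

lemma cw_commute:
  assumes "finite H" "u \<in> H" "w \<in> H"
  shows "cw H l u w = cw H l w u"
  using assms(2,3)
proof (induction l arbitrary: u w)
  case (Suc l)
  have "cw H (Suc l) u w = (\<Sum>x\<in>H. A u x * cw H l x w)" using assms(1) by (rule cw_Suc)
  also have "\<dots> = (\<Sum>x\<in>H. A u x * cw H l w x)" using Suc by simp
  also have "\<dots> = cw H (Suc l) w u" using Suc assms(1) by (simp add: cw_Suc_right)
  finally show ?case .
qed (simp add: cw_0)

lemma cw_double:
  assumes "finite H" "u \<in> H"
  shows "cw H (2 * s) u u = (\<Sum>x\<in>H. (cw H s u x)\<^sup>2)"
proof -
  have "cw H (2 * s) u u = (\<Sum>x\<in>H. cw H s u x * cw H s x u)"
    using cw_add[OF assms, of s s u] by (simp add: mult_2)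
  also have "\<dots> = (\<Sum>x\<in>H. (cw H s u x)\<^sup>2)"
    using assms by (intro sum.cong refl) (simp add: cw_commute[of H _ u] power2_eq_square)
  finally show ?thesis .
qed

lemma closed_walks_ge:
  assumes H: "H \<subseteq> V"
  shows "lam ^ (2 * s) * (real (card H) - (real CARD('n) + 1)) \<le> (\<Sum>u\<in>H. cw H (2 * s) u u)"
proof -
  have fH: "finite H" using assms finite_V finite_subset by blast
  obtain F where F: "finite F" "card F \<le> CARD('n) + 1"
    "\<forall>f\<in>F. \<forall>f'\<in>F. (\<Sum>h\<in>H. f h * f' h) = (if f = f' then 1 else 0)"
    and eig: "\<And>x v. (\<forall>f\<in>F. (\<Sum>h\<in>H. x h * f h) = 0) \<Longrightarrow> v \<in> H \<Longrightarrow> (\<Sum>h\<in>H. A v h * x h) = lam * x v"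
    using eigenspace_basis[OF H] by blast
  have eig': "(\<Sum>h\<in>H. cw H s v h * x h) = lam ^ s * x v"
    if x: "\<forall>f\<in>F. (\<Sum>h\<in>H. x h * f h) = 0" and "v \<in> H" for x v
    using that(2)
  proof (induction s arbitrary: v)
    case 0
    then show ?case using fH by (simp add: cw_0 if_distrib[of "\<lambda>x. x * _"] cong: if_cong)
  next
    case (Suc s)
    have "(\<Sum>h\<in>H. cw H (Suc s) v h * x h) = (\<Sum>y\<in>H. A v y * (\<Sum>h\<in>H. cw H s y h * x h))"
      unfolding cw_Suc[OF fH] sum_distrib_right sum_distrib_left
      by (subst sum.swap) (simp add: mult.assoc)
    also have "\<dots> = lam ^ s * (\<Sum>y\<in>H. A v y * x y)"
      using Suc by (simp add: sum_distrib_left mult.left_commute)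
    finally show ?case using eig[OF x \<open>v \<in> H\<close>] by simp
  qed
  have "lam ^ (2 * s) * (real (card H) - (real CARD('n) + 1)) \<le> lam ^ (2 * s) * (real (card H) - real (card F))"
    using F(2) lam_pos by (intro mult_left_mono) auto
  also have "\<dots> = (lam ^ s)\<^sup>2 * (real (card H) - real (card F))"
    by (simp only: power_mult[symmetric] mult.commute)
  also have "\<dots> = (\<Sum>v\<in>H. \<Sum>w\<in>H. (cw H s v w)\<^sup>2) - (\<Sum>f\<in>F. \<Sum>v\<in>H. (\<Sum>h\<in>H. cw H s v h * f h)\<^sup>2)"
    by (rule eigenspace_norm[OF F(1) fH F(3) eig', symmetric])
  also have "\<dots> \<le> (\<Sum>v\<in>H. \<Sum>w\<in>H. (cw H s v w)\<^sup>2)" by (simp add: sum_nonneg)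
  also have "\<dots> = (\<Sum>u\<in>H. cw H (2 * s) u u)" using fH by (simp add: cw_double)
  finally show ?thesis .
qed

text \<open>Since \<open>A\<close> is nonnegative, passing to absolute values only increases the
  form. On a support \<open>T\<close>, Cauchy-Schwarz turns the sum of absolute values in
  \<open>quad_le\<close> into a factor \<open>card T\<close>.\<close>

lemma abs_quad_le:
  assumes D: "\<And>v. v \<in> V \<Longrightarrow> deg v \<le> D" and T: "T \<subseteq> V" "\<And>v. v \<in> V - T \<Longrightarrow> x v = 0"
  shows "\<bar>quad x\<bar> \<le> (lam + 2 * D * real (card T) / n) * (\<Sum>v\<in>V. (x v)\<^sup>2)"
proof -
  have D0: "D \<ge> 0" using V_ne D deg_nonneg order_trans by blast
  have "(\<Sum>v\<in>V. \<bar>x v\<bar>) = (\<Sum>v\<in>T. 1 * \<bar>x v\<bar>)"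
    using T finite_V by (simp add: sum.mono_neutral_right)
  then have "(\<Sum>v\<in>V. \<bar>x v\<bar>)\<^sup>2 \<le> (\<Sum>v\<in>T. 1\<^sup>2) * (\<Sum>v\<in>T. \<bar>x v\<bar>\<^sup>2)"
    by (simp only: Cauchy_Schwarz_ineq_sum)
  also have "\<dots> \<le> real (card T) * (\<Sum>v\<in>V. (x v)\<^sup>2)"
    using T finite_V by (simp add: mult_left_mono sum_mono2)
  finally have "2 * D * (\<Sum>v\<in>V. \<bar>x v\<bar>)\<^sup>2 / n \<le> 2 * D * (real (card T) * (\<Sum>v\<in>V. (x v)\<^sup>2)) / n"
    using D0 n_pos by (intro divide_right_mono mult_left_mono) auto
  then have ub: "lam * (\<Sum>v\<in>V. (x v)\<^sup>2) + 2 * D * (\<Sum>v\<in>V. \<bar>x v\<bar>)\<^sup>2 / n \<le>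
      (lam + 2 * D * real (card T) / n) * (\<Sum>v\<in>V. (x v)\<^sup>2)"
    by (simp add: algebra_simps)
  have "\<bar>quad x\<bar> \<le> quad (\<lambda>v. \<bar>x v\<bar>)"
    unfolding quad_def
    by (intro order_trans[OF sum_abs] sum_mono order_trans[OF sum_abs])
       (simp add: abs_mult A_nonneg)
  also have "\<dots> \<le> lam * (\<Sum>v\<in>V. (x v)\<^sup>2) + 2 * D * (\<Sum>v\<in>V. \<bar>x v\<bar>)\<^sup>2 / n"
    using quad_le[of D "\<lambda>v. \<bar>x v\<bar>"] D by simp
  finally show ?thesis using ub by linarith
qed

text \<open>Polarisation: the form at \<open>f + y\<close> minus the form at \<open>f - y\<close> is
  four times the mixed term of \<open>f\<close> and \<open>y\<close>, and the parallelogram law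
  bounds the right side. The scaling \<open>y = g / \<mu>\<close> balances the two squared norms.
  Both \<open>f\<close> and \<open>A f\<close> must be supported in \<open>T\<close>.\<close>

lemma norm_A_le:
  assumes \<mu>: "\<mu> > 0" and T: "\<And>x. (\<And>v. v \<in> V - T \<Longrightarrow> x v = 0) \<Longrightarrow> \<bar>quad x\<bar> \<le> \<mu> * (\<Sum>v\<in>V. (x v)\<^sup>2)"
    and f: "\<And>v. v \<in> V - T \<Longrightarrow> f v = 0"
    and g: "\<And>v. v \<in> V \<Longrightarrow> g v = (\<Sum>w\<in>V. A v w * f w)" "\<And>v. v \<in> V - T \<Longrightarrow> g v = 0"
  shows "(\<Sum>v\<in>V. (g v)\<^sup>2) \<le> \<mu>\<^sup>2 * (\<Sum>v\<in>V. (f v)\<^sup>2)"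
proof -
  define S R where "S = (\<Sum>v\<in>V. (f v)\<^sup>2)" and "R = (\<Sum>v\<in>V. (g v)\<^sup>2)"
  define y where "y v = g v / \<mu>" for v
  have "(\<Sum>v\<in>V. \<Sum>w\<in>V. A v w * (y v * f w)) = (\<Sum>v\<in>V. y v * g v)"
    by (intro sum.cong refl) (simp add: g(1) sum_distrib_left mult.left_commute)
  also have "\<dots> = R / \<mu>" by (simp add: y_def R_def power2_eq_square sum_divide_distrib)
  finally have b1: "(\<Sum>v\<in>V. \<Sum>w\<in>V. A v w * (y v * f w)) = R / \<mu>" .
  have b2: "(\<Sum>v\<in>V. \<Sum>w\<in>V. A v w * (f v * y w)) = R / \<mu>"
    unfolding b1[symmetric] by (subst sum.swap) (simp add: A_commute mult.commute)
  have y2: "(\<Sum>v\<in>V. (y v)\<^sup>2) = R / \<mu>\<^sup>2"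
    by (simp add: y_def R_def power_divide sum_divide_distrib)
  have "quad (\<lambda>v. f v + y v) = quad f + quad y + 2 * (R / \<mu>)"
    using b1 b2 by (simp add: quad_def algebra_simps sum.distrib)
  moreover have "quad (\<lambda>v. f v - y v) = quad f + quad y - 2 * (R / \<mu>)"
    using b1 b2 by (simp add: quad_def algebra_simps sum.distrib sum_subtractf)
  moreover have "\<bar>quad (\<lambda>v. f v + y v)\<bar> \<le> \<mu> * (\<Sum>v\<in>V. (f v + y v)\<^sup>2)"
    by (rule T) (simp add: y_def f g(2))
  moreover have "\<bar>quad (\<lambda>v. f v - y v)\<bar> \<le> \<mu> * (\<Sum>v\<in>V. (f v - y v)\<^sup>2)"
    by (rule T) (simp add: y_def f g(2))
  ultimately have "4 * (R / \<mu>) \<le> \<mu> * ((\<Sum>v\<in>V. (f v + y v)\<^sup>2) + (\<Sum>v\<in>V. (f v - y v)\<^sup>2))"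
    by (simp add: distrib_left)
  also have "(\<Sum>v\<in>V. (f v + y v)\<^sup>2) + (\<Sum>v\<in>V. (f v - y v)\<^sup>2) = (\<Sum>v\<in>V. 2 * (f v)\<^sup>2 + 2 * (y v)\<^sup>2)"
    unfolding sum.distrib[symmetric] by (intro sum.cong refl) (simp add: power2_eq_square algebra_simps)
  also have "\<dots> = 2 * S + 2 * (R / \<mu>\<^sup>2)"
    by (simp add: sum.distrib S_def y2 flip: sum_distrib_left)
  finally have "R / \<mu> \<le> \<mu> * S" using \<mu> by (simp add: power2_eq_square field_simps)
  then show ?thesis using \<mu> by (simp add: S_def R_def power2_eq_square field_simps)
qed

text \<open>Walks of length \<open>i\<close> from \<open>v\<close> end in at most
  \<open>D ^ i\<close> vertices. Thus for \<open>i < s\<close> the rows of walk counts of lengths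
  \<open>i\<close> and \<open>i + 1\<close> have small joint support, on which one step of
  \<open>A\<close> increases the norm at most by the factor \<open>\<mu>\<close>. The row for
  \<open>s\<close> has squared norm equal to the number of closed walks.\<close>

lemma closed_walks_le:
  assumes D: "\<And>v. v \<in> V \<Longrightarrow> deg v \<le> D" and v: "v \<in> V" and \<mu>: "\<mu> = lam + 2 * D * (D + 1) ^ s / n"
  shows "cw V (2 * s) v v \<le> \<mu> ^ (2 * s)"
proof -
  have D0: "D \<ge> 0" using V_ne D deg_nonneg order_trans by blast
  have \<mu>0: "\<mu> > 0" unfolding \<mu> using D0 n_pos lam_pos by (intro add_pos_nonneg) auto
  define supp where "supp i = {w \<in> V. cw V i v w \<noteq> 0}" for i
  have fs: "finite (supp i)" for i using finite_V by (simp add: supp_def)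
  have card_supp: "real (card (supp i)) \<le> D ^ i" for i
  proof (induction i)
    case 0
    have "supp 0 = {v}" using v by (auto simp: supp_def cw_0)
    then show ?case by simp
  next
    case (Suc i)
    have "supp (Suc i) \<subseteq> (\<Union>x\<in>supp i. {w \<in> V. A x w \<noteq> 0})"
    proof
      fix w assume w: "w \<in> supp (Suc i)"
      then have "(\<Sum>x\<in>V. A w x * cw V i v x) \<noteq> 0"
        using v finite_V by (auto simp: supp_def cw_Suc_right)
      then obtain x where "x \<in> V" "A w x * cw V i v x \<noteq> 0"
        by (meson sum.not_neutral_contains_not_neutral)
      then show "w \<in> (\<Union>x\<in>supp i. {w \<in> V. A x w \<noteq> 0})"
        using w by (auto simp: supp_def A_commute)
    qed
    then have "real (card (supp (Suc i))) \<le> real (card (\<Union>x\<in>supp i. {w \<in> V. A x w \<noteq> 0}))"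
      using fs finite_V by (intro of_nat_mono card_mono finite_UN_I) auto
    also have "\<dots> \<le> (\<Sum>x\<in>supp i. real (card {w \<in> V. A x w \<noteq> 0}))"
      unfolding of_nat_sum[symmetric] using fs by (intro of_nat_mono card_UN_le)
    also have "\<dots> \<le> (\<Sum>x\<in>supp i. D)"
    proof (rule sum_mono)
      fix x assume x: "x \<in> supp i"
      have "real (card {w \<in> V. A x w \<noteq> 0}) = (\<Sum>w\<in>V. if A x w \<noteq> 0 then 1 else 0)"
        using finite_V by (simp add: sum.inter_filter[symmetric])
      also have "\<dots> = deg x" unfolding deg_def by (intro sum.cong) (auto simp: A_def)
      finally show "real (card {w \<in> V. A x w \<noteq> 0}) \<le> D" using D x by (auto simp: supp_def)
    qed
    also have "\<dots> \<le> D ^ i * D" using Suc D0 by (simp add: mult_right_mono)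
    finally show ?case by (simp add: mult.commute)
  qed
  have "(\<Sum>w\<in>V. (cw V i v w)\<^sup>2) \<le> \<mu> ^ (2 * i)" if "i \<le> s" for i
    using that
  proof (induction i)
    case 0
    show ?case using v finite_V by (simp add: cw_0 if_distrib[of "\<lambda>x. x\<^sup>2"] cong: if_cong)
  next
    case (Suc i)
    define T where "T = supp i \<union> supp (Suc i)"
    have "real (card T) \<le> real (card (supp i)) + real (card (supp (Suc i)))"
      unfolding T_def by (metis card_Un_le of_nat_add of_nat_mono)
    also have "\<dots> \<le> D ^ i + D ^ Suc i" by (intro add_mono card_supp)
    also have "\<dots> = D ^ i * (D + 1)" by (simp add: algebra_simps)
    also have "\<dots> \<le> (D + 1) ^ i * (D + 1)" using D0 by (intro mult_right_mono power_mono) auto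
    also have "\<dots> = (D + 1) ^ Suc i" by simp
    also have "\<dots> \<le> (D + 1) ^ s" using Suc.prems D0 by (intro power_increasing) auto
    finally have cT: "real (card T) \<le> (D + 1) ^ s" .
    have "(\<Sum>w\<in>V. (cw V (Suc i) v w)\<^sup>2) \<le> \<mu>\<^sup>2 * (\<Sum>w\<in>V. (cw V i v w)\<^sup>2)"
    proof (rule norm_A_le[OF \<mu>0, of T])
      fix x :: "real ^ 'n \<Rightarrow> real" assume "\<And>v. v \<in> V - T \<Longrightarrow> x v = 0"
      then have "\<bar>quad x\<bar> \<le> (lam + 2 * D * real (card T) / n) * (\<Sum>v\<in>V. (x v)\<^sup>2)"
        using D by (intro abs_quad_le) (auto simp: T_def supp_def)
      also have "\<dots> \<le> \<mu> * (\<Sum>v\<in>V. (x v)\<^sup>2)"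
        unfolding \<mu> using cT D0 n_pos
        by (intro mult_right_mono add_left_mono divide_right_mono mult_left_mono sum_nonneg) auto
      finally show "\<bar>quad x\<bar> \<le> \<mu> * (\<Sum>v\<in>V. (x v)\<^sup>2)" .
    qed (use v finite_V in \<open>auto simp: T_def supp_def cw_Suc_right\<close>)
    also have "\<dots> \<le> \<mu>\<^sup>2 * \<mu> ^ (2 * i)" using Suc by (intro mult_left_mono) auto
    finally show ?case by (simp add: power2_eq_square)
  qed
  then show ?thesis using v finite_V by (simp add: cw_double)
qed

text \<open>\<open>S\<close> holds the vertices visited so far. A step leads to one of at most
  \<open>k\<close> old vertices or to one of at most \<open>D\<close> new ones; the latter uses up
  one factor \<open>D\<close> of the remaining budget. Each step therefore costs a factor
  \<open>k + 1\<close> in total.\<close>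

lemma few_vertices_walks_le:
  assumes D: "\<And>v. v \<in> V \<Longrightarrow> deg v \<le> D" "D \<ge> 1"
    and "u \<in> S" "S \<subseteq> V" "card S \<le> k"
  shows "real (card {p \<in> walks V l u w. card (S \<union> set p) \<le> k}) \<le> real (k + 1) ^ l * D ^ (k - card S)"
  using assms(3-5)
proof (induction l arbitrary: u S)
  case 0
  have "{p \<in> walks V 0 u w. card (S \<union> set p) \<le> k} \<subseteq> {[u]}" by (auto split: if_splits)
  then have "card {p \<in> walks V 0 u w. card (S \<union> set p) \<le> k} \<le> 1"
    using card_mono[of "{[u]}"] by fastforce
  then have "real (card {p \<in> walks V 0 u w. card (S \<union> set p) \<le> k}) \<le> 1" by linarith
  also have "\<dots> \<le> D ^ (k - card S)" using D by simp
  finally show ?case by simp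
next
  case (Suc l)
  define N where "N = {x \<in> V. u \<bullet> x < 0}"
  define B where "B = real (k + 1) ^ l * D ^ (k - card S)"
  define W where "W x = {q \<in> walks V l x w. card (insert x S \<union> set q) \<le> k}" for x
  have B0: "B \<ge> 0" using D by (simp add: B_def)
  have fS: "finite S" using Suc.prems finite_V finite_subset by blast
  have fN: "finite N" using finite_V by (simp add: N_def)
  have fW: "finite (W x)" for x using finite_walks[OF finite_V] by (simp add: W_def)
  have degu: "real (card N) \<le> D"
  proof -
    have "real (card N) = deg u"
      unfolding N_def deg_def A_def using finite_V by (simp add: sum.inter_filter[symmetric])
    then show ?thesis using D Suc.prems by auto
  qed
  have old: "real (card (W x)) \<le> B" if "x \<in> N \<inter> S" for x
  proof -
    have "insert x S = S" using that by auto
    then show ?thesis unfolding W_def B_def using Suc.IH[of x S] Suc.prems that by simp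
  qed
  have new: "real (card (W x)) \<le> B / D" if "x \<in> N - S" for x
  proof (cases "card S + 1 \<le> k")
    case True
    have "real (card (W x)) \<le> real (k + 1) ^ l * D ^ (k - card (insert x S))"
      unfolding W_def using Suc.IH[of x "insert x S"] Suc.prems that True fS by (auto simp: N_def)
    also have "k - card S = Suc (k - card (insert x S))" using that True fS by simp
    then have "real (k + 1) ^ l * D ^ (k - card (insert x S)) = B / D"
      using D(2) by (simp add: B_def)
    finally show ?thesis .
  next
    \<comment> \<open>The budget is exhausted, so no walk may enter a new vertex.\<close>
    case False
    have "card S + 1 \<le> card (insert x S \<union> set q)" for q
      using that fS card_mono[of "insert x S \<union> set q" "insert x S"] by auto
    then have "\<not> card (insert x S \<union> set q) \<le> k" for q using False by (meson le_trans)
    then have "W x = {}" unfolding W_def by blast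
    then show ?thesis using B0 D(2) by simp
  qed
  have "{p \<in> walks V (Suc l) u w. card (S \<union> set p) \<le> k} \<subseteq> (\<Union>x\<in>N. (#) u ` W x)"
  proof
    fix p assume p: "p \<in> {p \<in> walks V (Suc l) u w. card (S \<union> set p) \<le> k}"
    then obtain x q where x: "x \<in> N" "q \<in> walks V l x w" "p = u # q" by (auto simp: N_def)
    have "S \<union> set p = insert x S \<union> set q"
      using hd_walk[OF x(2)] hd_in_set[of q] Suc.prems x(3) by auto
    then show "p \<in> (\<Union>x\<in>N. (#) u ` W x)" using p x by (auto simp: W_def)
  qed
  then have "real (card {p \<in> walks V (Suc l) u w. card (S \<union> set p) \<le> k}) \<le> real (card (\<Union>x\<in>N. (#) u ` W x))"
    using fN fW by (intro of_nat_mono card_mono finite_UN_I finite_imageI)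
  also have "\<dots> \<le> (\<Sum>x\<in>N. real (card ((#) u ` W x)))"
    unfolding of_nat_sum[symmetric] using fN by (intro of_nat_mono card_UN_le)
  also have "\<dots> = (\<Sum>x\<in>N. real (card (W x)))" by (simp add: card_image)
  also have "\<dots> = (\<Sum>x\<in>N \<inter> S. real (card (W x))) + (\<Sum>x\<in>N - S. real (card (W x)))"
    using fN by (rule sum.Int_Diff)
  also have "\<dots> \<le> (\<Sum>x\<in>N \<inter> S. B) + (\<Sum>x\<in>N - S. B / D)"
    using old new by (intro add_mono sum_mono) auto
  also have "\<dots> \<le> real k * B + D * (B / D)"
  proof -
    have "card (N \<inter> S) \<le> k" using card_mono[OF fS, of "N \<inter> S"] Suc.prems by simp
    moreover have "real (card (N - S)) \<le> D"
      using card_mono[OF fN, of "N - S"] degu by simp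
    ultimately show ?thesis using B0 D(2) by (simp add: add_mono mult_right_mono del: times_divide_eq_right)
  qed
  also have "\<dots> = real (k + 1) ^ Suc l * D ^ (k - card S)"
    using D(2) by (simp add: B_def algebra_simps)
  finally show ?case .
qed

end

section \<open>Vertex deletion\<close>

context equiangular_vectors
begin

text \<open>Count closed walks in \<open>H = V - T\<close>. From below the eigenvalue
  \<open>lam\<close> forces many; from above there are the walks on at most \<open>k\<close>
  vertices and the walks on more vertices that avoid \<open>T\<close>. A greedy choice of
  \<open>T\<close> leaves few of the latter.\<close>

lemma vertex_deletion:
  assumes D: "\<And>v. v \<in> V \<Longrightarrow> deg v \<le> D" "D \<ge> 1" and k: "1 \<le> k" "k + 1 \<le> card V"
    and \<mu>: "\<mu> = lam + 2 * D * (D + 1) ^ s / n"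
  shows "lam ^ (2 * s) * (n - real t - (real CARD('n) + 1)) \<le>
    n * (\<mu> ^ (2 * s) * (1 - real (k + 1) / n) ^ t + real (k + 1) ^ (2 * s) * D ^ k)"
proof -
  define R where "R u = {p \<in> walks V (2 * s) u u. \<not> card (set p) \<le> k}" for u
  define W where "W = (\<Union>u\<in>V. R u)"
  have fR: "finite (R u)" for u using finite_walks[OF finite_V] by (simp add: R_def)
  have fW: "finite W" using fR finite_V by (simp add: W_def)
  have disj: "R u \<inter> R v = {}" if "u \<noteq> v" for u v
    using that by (auto simp: R_def dest!: hd_walk)
  have "real (card W) = (\<Sum>u\<in>V. real (card (R u)))"
    unfolding W_def of_nat_sum[symmetric]
    using finite_V fR disj by (subst card_UN_disjoint) auto
  also have "\<dots> \<le> (\<Sum>u\<in>V. \<mu> ^ (2 * s))"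
  proof (rule sum_mono)
    fix u assume u: "u \<in> V"
    have "real (card (R u)) \<le> cw V (2 * s) u u"
      unfolding cw_def R_def using finite_walks[OF finite_V] by (intro of_nat_mono card_mono) auto
    also have "\<dots> \<le> \<mu> ^ (2 * s)" by (rule closed_walks_le[OF D(1) u \<mu>])
    finally show "real (card (R u)) \<le> \<mu> ^ (2 * s)" .
  qed
  finally have cW: "real (card W) \<le> n * \<mu> ^ (2 * s)" by simp
  have "\<exists>T\<subseteq>V. card T \<le> t \<and>
      real (card {p \<in> W. set p \<inter> T = {}}) \<le> (1 - real (k + 1) / n) ^ t * real (card W)"
  proof (rule greedy_hitting_set[OF fW finite_V V_ne k(2)])
    fix p assume "p \<in> W"
    then obtain u where u: "u \<in> V" "p \<in> R u" by (auto simp: W_def)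
    then show "set p \<subseteq> V" "k + 1 \<le> card (set p)"
      using set_walk[of p V "2 * s" u u] by (auto simp: R_def)
  qed
  then obtain T where T: "T \<subseteq> V" "card T \<le> t"
    "real (card {p \<in> W. set p \<inter> T = {}}) \<le> (1 - real (k + 1) / n) ^ t * real (card W)" by blast
  define H where "H = V - T"
  have H: "H \<subseteq> V" by (auto simp: H_def)
  have fT: "finite T" using T(1) finite_V by (rule finite_subset)
  have fH: "finite H" using H finite_V by (rule finite_subset)
  have "card H = card V - card T" unfolding H_def by (rule card_Diff_subset[OF fT T(1)])
  then have cH: "real (card H) \<ge> n - real t" using T(2) by linarith
  \<comment> \<open>As \<open>u\<close> lies on the walk, the union changes nothing; it matches
    \<open>few_vertices_walks_le\<close> with \<open>S = {u}\<close>.\<close>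
  define few where "few u = {p \<in> walks V (2 * s) u u. card ({u} \<union> set p) \<le> k}" for u
  define rich where "rich u = {p \<in> R u. set p \<inter> T = {}}" for u
  have split: "cw H (2 * s) u u \<le> real (card (few u)) + real (card (rich u))" if u: "u \<in> H" for u
  proof -
    have "walks H (2 * s) u u \<subseteq> few u \<union> rich u"
    proof
      fix p assume "p \<in> walks H (2 * s) u u"
      then have p: "p \<in> walks V (2 * s) u u" "set p \<subseteq> H" using walks_subset[OF H u] by auto
      have "u \<in> set p" using hd_walk[OF p(1)] hd_in_set[of p] by auto
      then have "{u} \<union> set p = set p" by auto
      then show "p \<in> few u \<union> rich u" using p by (auto simp: few_def rich_def R_def H_def)
    qed
    moreover have "finite (few u)" "finite (rich u)"
      using finite_walks[OF finite_V] fR by (auto simp: few_def rich_def)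
    ultimately have "card (walks H (2 * s) u u) \<le> card (few u) + card (rich u)"
      by (meson card_Un_le card_mono finite_UnI le_trans)
    then show ?thesis by (simp add: cw_def flip: of_nat_add)
  qed
  have few: "real (card (few u)) \<le> real (k + 1) ^ (2 * s) * D ^ k" if u: "u \<in> H" for u
  proof -
    have "real (card (few u)) \<le> real (k + 1) ^ (2 * s) * D ^ (k - card {u})"
      unfolding few_def using u H k(1) by (intro few_vertices_walks_le[OF D]) auto
    also have "\<dots> \<le> real (k + 1) ^ (2 * s) * D ^ k"
      using D(2) by (intro mult_left_mono power_increasing) auto
    finally show ?thesis .
  qed
  have "(\<Sum>u\<in>H. real (card (rich u))) = real (card (\<Union>u\<in>H. rich u))"
    unfolding of_nat_sum[symmetric] using fH fR disj
    by (subst card_UN_disjoint) (auto simp: rich_def)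
  also have "\<dots> \<le> real (card {p \<in> W. set p \<inter> T = {}})"
    using H by (intro of_nat_mono card_mono finite_subset[OF _ fW]) (auto simp: rich_def W_def)
  also have "\<dots> \<le> (1 - real (k + 1) / n) ^ t * (n * \<mu> ^ (2 * s))"
    using T(3) cW n_pos k(2) by (elim order_trans) (intro mult_left_mono zero_le_power, auto simp: field_simps)
  finally have rich: "(\<Sum>u\<in>H. real (card (rich u))) \<le> (1 - real (k + 1) / n) ^ t * (n * \<mu> ^ (2 * s))" .
  have "lam ^ (2 * s) * (n - real t - (real CARD('n) + 1)) \<le>
      lam ^ (2 * s) * (real (card H) - (real CARD('n) + 1))"
    using cH lam_pos by (intro mult_left_mono) auto
  also have "\<dots> \<le> (\<Sum>u\<in>H. cw H (2 * s) u u)" by (rule closed_walks_ge[OF H])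
  also have "\<dots> \<le> (\<Sum>u\<in>H. real (card (few u)) + real (card (rich u)))"
    using split by (rule sum_mono)
  also have "\<dots> \<le> (\<Sum>u\<in>H. real (k + 1) ^ (2 * s) * D ^ k) + (1 - real (k + 1) / n) ^ t * (n * \<mu> ^ (2 * s))"
    unfolding sum.distrib using few rich by (intro add_mono sum_mono) auto
  also have "(\<Sum>u\<in>H. real (k + 1) ^ (2 * s) * D ^ k) \<le> n * (real (k + 1) ^ (2 * s) * D ^ k)"
    using card_mono[OF finite_V H] D(2) by (simp add: mult_right_mono)
  finally show ?thesis by (simp add: algebra_simps)
qed

end

section \<open>Elementary consequences of a claimed maximum below 2\<close>

lemma ln_2_le: "ln 2 \<le> (7 / 10 :: real)"
  using ln_2_less_1 ln2_le_25_over_36 by simp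

lemma le_log2I: "2 ^ k \<le> x \<Longrightarrow> real k \<le> log 2 x"
  by (metis le_log_of_power one_less_numeral_iff semiring_norm(76))

text \<open>Bootstrap: a lower bound \<open>k\<close> for the logarithm turns the assumption into
  \<open>\<alpha> < 2 / (17 * k)\<close>, which in turn raises \<open>k\<close>. The values of
  \<open>k\<close> are 1, 4 and 6.\<close>

lemma alpha_small:
  assumes "0 < \<alpha>" "\<alpha> < 1" "17 * \<alpha> * log 2 (2 / \<alpha>) < (2::real)"
  shows "\<alpha> < 1 / 51" "6 \<le> log 2 (2 / \<alpha>)"
proof -
  have step: "\<alpha> < 2 / (17 * real k) \<and> real k \<le> log 2 (2 / \<alpha>)" if "2 ^ k \<le> 2 / \<alpha>" "k > 0" for k
  proof -
    have k: "real k \<le> log 2 (2 / \<alpha>)" using that(1) by (rule le_log2I)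
    have "17 * \<alpha> * real k \<le> 17 * \<alpha> * log 2 (2 / \<alpha>)" using k assms by (intro mult_left_mono) auto
    then have "17 * \<alpha> * real k < 2" using assms(3) by linarith
    then show ?thesis using k that by (simp add: field_simps)
  qed
  have "2 ^ 1 \<le> 2 / \<alpha>" using assms by (simp add: field_simps)
  then have "\<alpha> < 2 / 17" using step[of 1] by simp
  then have "2 ^ 4 \<le> 2 / \<alpha>" using assms by (simp add: field_simps)
  then have "\<alpha> < 2 / 68" using step[of 4] by simp
  then have "2 ^ 6 \<le> 2 / \<alpha>" using assms by (simp add: field_simps)
  then show "\<alpha> < 1 / 51" "6 \<le> log 2 (2 / \<alpha>)" using step[of 6] by auto
qed

text \<open>The same bootstrap: \<open>L \<ge> 2 ^ k\<close> implies
  \<open>L \<ge> 33 * k\<^sup>2\<close>, which lifts \<open>k\<close> from 2 to 7 and then to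
  10.\<close>

lemma log_log_large:
  assumes "L \<ge> 4" "66 * (log 2 L)\<^sup>2 / L < (2::real)"
  shows "10 \<le> log 2 L" "330 * log 2 L \<le> L"
proof -
  have L: "33 * (log 2 L)\<^sup>2 \<le> L" using assms by (simp add: field_simps)
  have step: "33 * real k ^ 2 \<le> L" if "2 ^ k \<le> L" for k
  proof -
    have "real k ^ 2 \<le> (log 2 L)\<^sup>2" using le_log2I[OF that] by (intro power_mono) auto
    then show ?thesis using L by linarith
  qed
  have "2 ^ 7 \<le> L" using step[of 2] assms by simp
  then have "2 ^ 10 \<le> L" using step[of 7] by simp
  then show l: "10 \<le> log 2 L" using le_log2I[of 10 L] by simp
  then have "10 * log 2 L \<le> (log 2 L)\<^sup>2" by (simp add: power2_eq_square mult_right_mono)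
  then show "330 * log 2 L \<le> L" using L by linarith
qed

section \<open>Numerical estimates\<close>

text \<open>Here \<open>N\<close> is the number of lines in dimension \<open>\<rho>\<close>. Closed walks have length \<open>2 s\<close>; most of
  those that meet at least \<open>m\<close> vertices are destroyed by deleting \<open>t\<close> vertices.\<close>

locale large_dimension =
  fixes \<alpha> \<rho> x N :: real
  assumes alpha: "0 < \<alpha>" "\<alpha> < 1" and rho: "\<rho> \<ge> 1 / \<alpha> ^ 4" and N: "N \<ge> \<rho>"
    and x2: "x < 2"
    and x_ge: "66 * (log 2 (log (1 / \<alpha>) \<rho>))\<^sup>2 / log (1 / \<alpha>) \<rho> \<le> x"
      "17 * \<alpha> * log 2 (2 / \<alpha>) \<le> x"
begin

definition L where "L = log (1 / \<alpha>) \<rho>"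
definition lm where "lm = (1 - \<alpha>) / (2 * \<alpha>)"
text \<open>The quarter ensures \<open>(1 / \<alpha>) ^ (4 * s) \<le> \<rho>\<close>, which
  outweighs the supports of size \<open>(D + 1) ^ s \<le> (1 / \<alpha>) ^ (2 * s)\<close>.\<close>

definition s where "s = nat \<lfloor>L / 4\<rfloor>"
text \<open>The first bound gains a factor 2 against \<open>lm\<close> at each step to an old
  vertex; the second keeps \<open>m ^ (2 * k)\<close> below \<open>2 powr (L / 5)\<close> for
  \<open>k < m\<close>.\<close>

definition m where "m = nat \<lfloor>min (lm / 2) (L / (10 * log 2 L))\<rfloor>"
definition t where "t = nat \<lceil>N * x / 4\<rceil>"

lemma a51: "\<alpha> < 1 / 51" and log_alpha: "6 \<le> log 2 (2 / \<alpha>)"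
  by (rule alpha_small[OF alpha le_less_trans[OF x_ge(2) x2]])+

lemma base: "1 / \<alpha> > 51" using a51 alpha by (simp add: field_simps)

lemma L4: "L \<ge> 4"
proof -
  have "(1 / \<alpha>) ^ 4 \<le> \<rho>" using rho by (simp add: power_one_over)
  then have "real 4 \<le> log (1 / \<alpha>) \<rho>" using base by (intro le_log_of_power) auto
  then show ?thesis by (simp add: L_def)
qed

lemma log_L: "10 \<le> log 2 L" and L_ge: "330 * log 2 L \<le> L"
  by (rule log_log_large[OF L4 le_less_trans[OF x_ge(1)[folded L_def] x2]])+

lemma L_big: "L \<ge> 3300" using log_L L_ge by linarith

lemma L_powr: "L = 2 powr log 2 L" using L_big by simp

lemma rho_powr: "\<rho> = (1 / \<alpha>) powr L"
proof -
  have "\<rho> > 0" using rho alpha by (smt (verit) divide_pos_pos zero_less_power)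
  then show ?thesis unfolding L_def using base alpha by (intro powr_log_cancel[symmetric]) auto
qed

lemma N_ge_powr: "N \<ge> (1 / \<alpha>) powr L" using N unfolding rho_powr[symmetric] .

text \<open>As \<open>log 2 L\<close> is at least 10, \<open>x\<close> is at least
  \<open>6600 / L\<close>, and 36 * 183 = 6588.\<close>

lemma inverse_L_le: "183 / L \<le> x / 36"
proof -
  have "10\<^sup>2 \<le> (log 2 L)\<^sup>2" using log_L by (intro power_mono) auto
  then have "66 * 100 / L \<le> 66 * (log 2 L)\<^sup>2 / L" using L_big by (intro divide_right_mono) auto
  also have "\<dots> \<le> x" using x_ge by (simp add: L_def)
  finally have "66 * 100 / L \<le> x" .
  moreover have "36 * (183 / L) \<le> 66 * 100 / L" using L_big by (simp add: field_simps)
  ultimately show ?thesis by linarith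
qed

lemma N_ge_L: "N \<ge> L"
proof -
  have "L = 2 powr log 2 L" by (rule L_powr)
  also have "\<dots> \<le> 2 powr L" using L_ge log_L by (intro powr_mono) auto
  also have "\<dots> \<le> (1 / \<alpha>) powr L" using base L_big by (intro powr_mono2) auto
  also have "\<dots> \<le> N" by (rule N_ge_powr)
  finally show ?thesis .
qed

lemma s_bounds: "real s \<le> L / 4" "L / 4 < real s + 1" "s \<ge> 800"
proof -
  have "real s = real_of_int \<lfloor>L / 4\<rfloor>" using L_big by (simp add: s_def)
  then show *: "real s \<le> L / 4" "L / 4 < real s + 1" by linarith+
  then show "s \<ge> 800" using L_big by linarith
qed

lemma lam_bounds: "lm / 2 \<ge> 12" "2 * lm\<^sup>2 + 1 \<le> 1 / \<alpha>\<^sup>2" "lm > 0"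
proof -
  show "lm / 2 \<ge> 12" "lm > 0" using a51 alpha by (auto simp: lm_def field_simps)
  have "2 * lm\<^sup>2 = (1 - \<alpha>)\<^sup>2 / (2 * \<alpha>\<^sup>2)" by (simp add: lm_def power_divide power_mult_distrib)
  also have "\<dots> \<le> 1 / (2 * \<alpha>\<^sup>2)" using alpha by (intro divide_right_mono) (auto simp: power_le_one)
  finally have "2 * lm\<^sup>2 + 1 \<le> 1 / (2 * \<alpha>\<^sup>2) + 1" by simp
  moreover have "\<alpha>\<^sup>2 \<le> (1 / 51)\<^sup>2" using a51 alpha by (intro power_mono) auto
  then have "1 \<le> 1 / (2 * \<alpha>\<^sup>2)" using alpha by (simp add: power_divide)
  ultimately show "2 * lm\<^sup>2 + 1 \<le> 1 / \<alpha>\<^sup>2" by simp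
qed

lemma m_bounds: "real m \<le> lm / 2" "real m \<le> L / (10 * log 2 L)" "m \<ge> 12"
  "min (lm / 2) (L / (10 * log 2 L)) < real m + 1"
proof -
  have "33 \<le> L / (10 * log 2 L)" using L_ge log_L by (simp add: field_simps)
  then have K: "12 \<le> min (lm / 2) (L / (10 * log 2 L))" using lam_bounds(1) by simp
  then have "real m = real_of_int \<lfloor>min (lm / 2) (L / (10 * log 2 L))\<rfloor>" unfolding m_def by simp
  then have "real m \<le> min (lm / 2) (L / (10 * log 2 L))"
    and *: "min (lm / 2) (L / (10 * log 2 L)) < real m + 1" by linarith+
  then show "real m \<le> lm / 2" "real m \<le> L / (10 * log 2 L)"
    "min (lm / 2) (L / (10 * log 2 L)) < real m + 1" by auto
  show "m \<ge> 12" using K * by linarith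
qed

lemma m_le_L: "real m \<le> L" "100 * real m \<le> L"
proof -
  have "real m \<le> L / (10 * log 2 L)" by (rule m_bounds)
  also have "\<dots> \<le> L / (10 * 10)" using log_L L_big by (intro divide_left_mono) auto
  finally show "100 * real m \<le> L" by simp
  then show "real m \<le> L" using L_big by simp
qed

text \<open>The error relative to \<open>lm\<close> is at most \<open>1 / (2 * s)\<close>, because
  \<open>N\<close> dominates \<open>(1 / \<alpha>) ^ (4 * s)\<close>. Raised to the power
  \<open>2 * s\<close> the quotient stays below \<open>exp 1\<close>.\<close>

lemma perturbation_le:
  assumes D: "0 \<le> D" "D \<le> 2 * lm\<^sup>2"
  shows "((lm + 2 * D * (D + 1) ^ s / N) / lm) ^ (2 * s) \<le> 3"
proof -
  define b where "b = 1 / \<alpha>"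
  have b: "b > 51" using base by (simp add: b_def)
  have D1: "D + 1 \<le> b\<^sup>2" using D lam_bounds(2) by (simp add: b_def power_one_over)
  have "2 * D * (D + 1) ^ s \<le> 2 * b\<^sup>2 * (b\<^sup>2) ^ s"
    using D D1 by (intro mult_mono power_mono) auto
  also have "\<dots> = 2 * b ^ (2 * s + 2)" by (simp add: power_add power_mult power2_eq_square)
  finally have 1: "2 * D * (D + 1) ^ s \<le> 2 * b ^ (2 * s + 2)" .
  have "b ^ (4 * s) = b powr real (4 * s)" using b by (intro powr_realpow[symmetric]) auto
  also have "\<dots> \<le> b powr L" using b s_bounds(1) by (intro powr_mono) auto
  also have "\<dots> \<le> N" using N_ge_powr by (simp add: b_def)
  finally have 2: "b ^ (4 * s) \<le> N" .
  have "2 * D * (D + 1) ^ s / N \<le> 2 * b ^ (2 * s + 2) / b ^ (4 * s)"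
    using 1 2 b by (intro frac_le) auto
  also have "\<dots> = 2 / b ^ (2 * s - 2)"
  proof -
    have eq: "4 * s = (2 * s + 2) + (2 * s - 2)" using s_bounds(3) by simp
    have "b ^ (4 * s) = b ^ (2 * s + 2) * b ^ (2 * s - 2)" by (subst eq) (rule power_add)
    then show ?thesis using b by simp
  qed
  also have "\<dots> \<le> 2 / (4 * real s)"
  proof (rule divide_left_mono)
    have "4 * real s \<le> 2 ^ (s + 2)" using of_nat_less_two_power[of s, where 'a = real] by simp
    also have "\<dots> \<le> 2 ^ (2 * s - 2)" using s_bounds(3) by (intro power_increasing) auto
    also have "\<dots> \<le> b ^ (2 * s - 2)" using b by (intro power_mono) auto
    finally show "4 * real s \<le> b ^ (2 * s - 2)" .
  qed (use b s_bounds in auto)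
  also have "\<dots> \<le> lm * (1 / (2 * real s))"
    using lam_bounds(1) s_bounds(3) by (simp add: field_simps)
  finally have 3: "2 * D * (D + 1) ^ s / N \<le> lm * (1 / (2 * real s))" .
  have "(lm + 2 * D * (D + 1) ^ s / N) / lm \<le> (lm + lm * (1 / (2 * real s))) / lm"
    using 3 lam_bounds(3) by (intro divide_right_mono) auto
  also have "\<dots> = 1 + 1 / (2 * real s)" using lam_bounds(3) by (simp add: add_divide_distrib)
  also have "\<dots> \<le> exp (1 / (2 * real s))" by (rule exp_ge_add_one_self)
  finally have "((lm + 2 * D * (D + 1) ^ s / N) / lm) ^ (2 * s) \<le> exp (1 / (2 * real s)) ^ (2 * s)"
    using D lam_bounds(3) N_ge_L L_big by (intro power_mono divide_nonneg_nonneg add_nonneg_nonneg) auto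
  also have "\<dots> = exp 1" using s_bounds(3) by (simp flip: exp_of_nat_mult)
  also have "\<dots> \<le> 3" by (rule exp_le)
  finally show ?thesis .
qed

text \<open>By the choice of \<open>m\<close> the term is at most
  \<open>2 ^ k * m ^ (2 * k) / 2 ^ (2 * s - 2 * k)\<close>. Here \<open>2 * s\<close> is about
  \<open>L / 2\<close>, whereas the numerator has exponent at most \<open>L / 100 + L / 5\<close>,
  so what remains is below \<open>1 / L\<close>.\<close>

lemma few_term_le:
  assumes D: "0 \<le> D" "D \<le> 2 * lm\<^sup>2" and k: "m = k + 1"
  shows "real m ^ (2 * s) * D ^ k / lm ^ (2 * s) \<le> x / 36"
proof -
  have m0: "real m > 0" using m_bounds(3) by simp
  have ks: "2 * k \<le> 2 * s" using m_le_L(2) s_bounds(2) k L_big by linarith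
  have "D ^ k / lm ^ (2 * s) \<le> (2 * lm\<^sup>2) ^ k / lm ^ (2 * s)"
    using D lam_bounds(3) by (intro divide_right_mono power_mono) auto
  also have "\<dots> = 2 ^ k / lm ^ (2 * s - 2 * k)"
  proof -
    have "lm ^ (2 * s) = lm ^ (2 * k) * lm ^ (2 * s - 2 * k)" using ks by (simp flip: power_add)
    then show ?thesis using lam_bounds(3) by (simp add: power_mult_distrib flip: power_mult)
  qed
  also have "\<dots> \<le> 2 ^ k / (2 * real m) ^ (2 * s - 2 * k)"
    using m_bounds(1) m0 lam_bounds(3) by (intro divide_left_mono power_mono) auto
  finally have "real m ^ (2 * s) * (D ^ k / lm ^ (2 * s)) \<le>
      real m ^ (2 * s) * (2 ^ k / (2 * real m) ^ (2 * s - 2 * k))"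
    by (intro mult_left_mono) auto
  also have "\<dots> = 2 ^ k * real m ^ (2 * k) / 2 ^ (2 * s - 2 * k)"
  proof -
    have "real m ^ (2 * s) = real m ^ (2 * k) * real m ^ (2 * s - 2 * k)" using ks by (simp flip: power_add)
    then show ?thesis using m0 by (simp add: power_mult_distrib)
  qed
  also have "\<dots> \<le> 2 powr k * 2 powr (L / 5) / 2 powr (2 * s - 2 * k)"
  proof -
    have "real m ^ (2 * k) \<le> L ^ (2 * k)" using m_le_L(1) by (intro power_mono) auto
    also have "\<dots> = (2 powr log 2 L) powr real (2 * k)"
      using L_big by (simp add: powr_realpow[symmetric])
    also have "\<dots> = 2 powr (log 2 L * real (2 * k))" by (rule powr_powr)
    also have "\<dots> \<le> 2 powr (L / 5)"
    proof (rule powr_mono)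
      have "log 2 L * (10 * real m) \<le> L" using m_bounds(2) log_L by (simp add: field_simps)
      moreover have "log 2 L * (10 * real k) \<le> log 2 L * (10 * real m)"
        using k log_L by (intro mult_left_mono) auto
      ultimately have "log 2 L * (10 * real k) \<le> L" by linarith
      then show "log 2 L * real (2 * k) \<le> L / 5" by simp
    qed simp
    finally have "real m ^ (2 * k) \<le> 2 powr (L / 5)" .
    moreover have "(2::real) ^ k = 2 powr k" "(2::real) ^ (2 * s - 2 * k) = 2 powr (2 * s - 2 * k)"
      using ks by (simp_all add: powr_realpow[symmetric] of_nat_diff)
    ultimately show ?thesis by (simp add: divide_right_mono mult_left_mono)
  qed
  also have "\<dots> = 2 powr (k + L / 5 - (2 * s - 2 * k))" by (simp add: powr_add powr_diff)
  also have "\<dots> \<le> 2 powr (- log 2 L)"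
  proof (rule powr_mono)
    have "real k \<le> L / 100" using m_le_L(2) k by simp
    then show "real k + L / 5 - real (2 * s - 2 * k) \<le> - log 2 L"
      using s_bounds(2) L_ge L_big ks by (simp only: of_nat_diff of_nat_mult of_nat_numeral)
  qed simp
  also have "\<dots> = 1 / L" using L_big by (simp add: powr_minus_divide)
  also have "\<dots> \<le> 183 / L" using L_big by (intro divide_right_mono) auto
  also have "\<dots> \<le> x / 36" by (rule inverse_L_le)
  finally show ?thesis by simp
qed

text \<open>The two lower bounds on \<open>x\<close> correspond to the two bounds in the minimum
  defining \<open>m\<close>. In either case \<open>m * x / 4\<close> exceeds the natural logarithm
  of \<open>2 / \<alpha>\<close> or of \<open>L\<close>, so the exponential is at most
  \<open>\<alpha> / 2\<close> or \<open>1 / L\<close>.\<close>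

lemma exp_term_le: "3 * exp (- (real m * x / 4)) \<le> x / 36"
proof (cases "lm / 2 \<le> L / (10 * log 2 L)")
  case True
  have "17 * \<alpha> * 6 \<le> 17 * \<alpha> * log 2 (2 / \<alpha>)" using alpha log_alpha by (intro mult_left_mono) auto
  then have xa: "102 * \<alpha> \<le> x" using x_ge(2) by simp
  have "(1 - 5 * \<alpha>) / (4 * \<alpha>) \<le> real m"
  proof -
    have "lm / 2 < real m + 1" using m_bounds(4) True by simp
    moreover have "lm / 2 - 1 = (1 - 5 * \<alpha>) / (4 * \<alpha>)" using alpha by (simp add: lm_def field_simps)
    ultimately show ?thesis by linarith
  qed
  then have "(1 - 5 * \<alpha>) / (4 * \<alpha>) * (17 * \<alpha> * log 2 (2 / \<alpha>)) \<le> real m * x"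
    using x_ge(2) alpha log_alpha by (intro mult_mono) auto
  moreover have "(1 - 5 * \<alpha>) / (4 * \<alpha>) * (17 * \<alpha> * log 2 (2 / \<alpha>)) = 17 / 4 * (1 - 5 * \<alpha>) * log 2 (2 / \<alpha>)"
    using alpha by simp
  \<comment> \<open>46/51 is the value of \<open>1 - 5 * \<alpha>\<close> at
    \<open>\<alpha> = 1 / 51\<close>.\<close>
  moreover have "17 / 4 * (46 / 51) * log 2 (2 / \<alpha>) \<le> 17 / 4 * (1 - 5 * \<alpha>) * log 2 (2 / \<alpha>)"
    using a51 log_alpha by (intro mult_right_mono) auto
  ultimately have "7 / 10 * log 2 (2 / \<alpha>) \<le> real m * x / 4" using log_alpha by linarith
  moreover have "ln (2 / \<alpha>) = ln 2 * log 2 (2 / \<alpha>)" by (simp add: log_def)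
  moreover have "ln 2 * log 2 (2 / \<alpha>) \<le> 7 / 10 * log 2 (2 / \<alpha>)"
    using ln_2_le log_alpha by (intro mult_right_mono) auto
  ultimately have "- (real m * x / 4) \<le> - ln (2 / \<alpha>)" by linarith
  then have "exp (- (real m * x / 4)) \<le> exp (- ln (2 / \<alpha>))" by simp
  also have "\<dots> = \<alpha> / 2" using alpha by (simp add: exp_minus)
  finally show ?thesis using xa alpha by linarith
next
  case False
  have "66 * (log 2 L)\<^sup>2 / L \<le> x" using x_ge by (simp add: L_def)
  moreover have "L / (12 * log 2 L) \<le> real m"
  proof -
    have "L / (10 * log 2 L) < real m + 1" using m_bounds(4) False by simp
    \<comment> \<open>Passing from 10 to 12 absorbs the rounding in \<open>m\<close>.\<close>
    moreover have "1 \<le> L / (10 * log 2 L) - L / (12 * log 2 L)"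
      using L_ge log_L by (simp add: field_simps)
    ultimately show ?thesis by linarith
  qed
  ultimately have "L / (12 * log 2 L) * (66 * (log 2 L)\<^sup>2 / L) \<le> real m * x"
    using log_L L_big by (intro mult_mono) auto
  moreover have "L / (12 * log 2 L) * (66 * (log 2 L)\<^sup>2 / L) = 66 / 12 * log 2 L"
    using log_L L_big by (simp add: power2_eq_square)
  ultimately have "7 / 10 * log 2 L \<le> real m * x / 4" using log_L by linarith
  moreover have "ln L = ln 2 * log 2 L" by (simp add: log_def)
  moreover have "ln 2 * log 2 L \<le> 7 / 10 * log 2 L"
    using ln_2_le log_L by (intro mult_right_mono) auto
  ultimately have "- (real m * x / 4) \<le> - ln L" by linarith
  then have "exp (- (real m * x / 4)) \<le> exp (- ln L)" by simp
  also have "\<dots> = 1 / L" using L_big by (simp add: exp_minus inverse_eq_divide)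
  also have "3 * (1 / L) \<le> 183 / L" using L_big by (simp add: field_simps)
  finally show ?thesis using inverse_L_le by linarith
qed

text \<open>After division by \<open>lm ^ (2 * s)\<close>, the deleted vertices account for
  \<open>N * x / 4\<close>. The surviving long walks, the walks on few vertices and the rounding
  constant 2 take at most \<open>N * x / 36\<close> each, and 1/4 + 3/36 = 1/3.\<close>

lemma surplus_le:
  assumes D: "0 \<le> D" "D \<le> 2 * lm\<^sup>2" and k: "m = k + 1"
    and \<mu>: "\<mu> = lm + 2 * D * (D + 1) ^ s / N"
    and del: "lm ^ (2 * s) * (N - real t - (\<rho> + 1)) \<le>
      N * (\<mu> ^ (2 * s) * (1 - real m / N) ^ t + real m ^ (2 * s) * D ^ k)"
  shows "N - \<rho> \<le> N * x / 3"
proof -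
  have N0: "N > 0" using N_ge_L L_big by linarith
  have mN: "real m \<le> N" using m_le_L N_ge_L by linarith
  have x0: "x > 0" using inverse_L_le L_big divide_pos_pos[of 183 L] by linarith
  have t: "N * x / 4 \<le> real t" "real t \<le> N * x / 4 + 1"
  proof -
    have "0 \<le> N * x / 4" using x0 N0 by simp
    then have "real t = real_of_int \<lceil>N * x / 4\<rceil>" unfolding t_def by simp
    then show "N * x / 4 \<le> real t" "real t \<le> N * x / 4 + 1" by linarith+
  qed
  have "(1 - real m / N) ^ t \<le> exp (- (real m / N)) ^ t"
    using mN N0 exp_ge_add_one_self[of "- (real m / N)"] by (intro power_mono) auto
  also have "\<dots> = exp (real t * - (real m / N))" by (simp flip: exp_of_nat_mult)
  also have "\<dots> \<le> exp (- (real m * x / 4))"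
  proof -
    have "real m / N * (N * x / 4) \<le> real m / N * real t" using t N0 by (intro mult_left_mono) auto
    then show ?thesis using N0 by (simp add: mult.commute)
  qed
  finally have e: "(1 - real m / N) ^ t \<le> exp (- (real m * x / 4))" .
  have "N - real t - (\<rho> + 1) \<le>
      N * (\<mu> ^ (2 * s) * (1 - real m / N) ^ t + real m ^ (2 * s) * D ^ k) / lm ^ (2 * s)"
    using del lam_bounds(3) by (simp add: field_simps)
  also have "\<dots> = N * ((\<mu> / lm) ^ (2 * s) * (1 - real m / N) ^ t + real m ^ (2 * s) * D ^ k / lm ^ (2 * s))"
    by (simp add: power_divide distrib_left add_divide_distrib)
  also have "\<dots> \<le> N * (3 * exp (- (real m * x / 4)) + x / 36)"
  proof (intro mult_left_mono add_mono mult_mono)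
    show "(\<mu> / lm) ^ (2 * s) \<le> 3" unfolding \<mu> by (rule perturbation_le[OF D])
    show "real m ^ (2 * s) * D ^ k / lm ^ (2 * s) \<le> x / 36" by (rule few_term_le[OF D k])
  qed (use e N0 mN in auto)
  also have "\<dots> \<le> N * (x / 36 + x / 36)"
    using exp_term_le N0 by (intro mult_left_mono add_right_mono) auto
  finally have "N - \<rho> \<le> N * (x / 36 + x / 36) + real t + 1" by simp
  also have "\<dots> \<le> N * (x / 36 + x / 36) + N * x / 4 + 2" using t by simp
  also have "2 \<le> N * (x / 36)"
  proof -
    have "2 \<le> L * (183 / L)" using L_big by simp
    also have "\<dots> \<le> N * (x / 36)" using N_ge_L inverse_L_le L_big by (intro mult_mono) auto
    finally show ?thesis .
  qed
  finally show ?thesis by (simp add: algebra_simps)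
qed

end

section \<open>Equiangular lines\<close>

context oriented_equiangular_vectors
begin

text \<open>If the bound fails, then \<open>n * \<alpha> ^ 4 \<ge> 1 + x\<close>, which feeds the
  degree bounds. For \<open>\<alpha> \<ge> 1 / 2\<close> the graph has no edges and
  \<open>n \<le> \<rho> + 1\<close>; for smaller \<open>\<alpha>\<close> the rank bound settles
  \<open>x \<ge> 2\<close>, and vertex deletion settles \<open>x < 2\<close>.\<close>

lemma card_bound:
  assumes r: "real CARD('n) \<ge> 1 / \<alpha> ^ 4"
  shows "n \<le> real CARD('n) + real CARD('n) *
    max (66 * (log 2 (log (1 / \<alpha>) (real CARD('n))))\<^sup>2 / log (1 / \<alpha>) (real CARD('n)))
      (17 * \<alpha> * log 2 (2 / \<alpha>))"
proof (rule ccontr)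
  define \<rho> where "\<rho> = real CARD('n)"
  define x where "x = max (66 * (log 2 (log (1 / \<alpha>) \<rho>))\<^sup>2 / log (1 / \<alpha>) \<rho>) (17 * \<alpha> * log 2 (2 / \<alpha>))"
  assume "\<not> ?thesis"
  then have big: "\<rho> * (1 + x) < n" by (simp add: \<rho>_def x_def algebra_simps)
  have rho0: "\<rho> \<ge> 1" using zero_less_card_finite[where 'a = 'n] unfolding \<rho>_def by linarith
  have rho: "\<rho> * \<alpha> ^ 4 \<ge> 1" "\<rho> \<ge> (1 / \<alpha>) ^ 4"
    using r alpha_pos by (auto simp: \<rho>_def field_simps power_one_over)
  have xa: "17 * \<alpha> * log 2 (2 / \<alpha>) \<le> x" by (simp add: x_def)
  have ln2: "log 2 y \<ge> ln y" if "y \<ge> 1" for y :: real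
    using that ln_2_less_1 by (simp add: log_def le_divide_eq mult_left_le)
  have log1: "log 2 (2 / \<alpha>) = 1 + log 2 (1 / \<alpha>)"
    using alpha_pos by (simp add: log_divide)
  \<comment> \<open>This yields a bound on \<open>x\<close> free of logarithms, which gives
    \<open>x > 0\<close> and serves the case \<open>\<alpha> \<ge> 1 / 2\<close>.\<close>
  have "ln \<alpha> \<le> \<alpha> - 1" using alpha_pos by (rule ln_le_minus_one)
  then have "1 - \<alpha> \<le> log 2 (1 / \<alpha>)"
    using ln2[of "1 / \<alpha>"] alpha_pos alpha_less_1 by (simp add: ln_div)
  then have "17 * \<alpha> * (2 - \<alpha>) \<le> 17 * \<alpha> * log 2 (2 / \<alpha>)"
    using alpha_pos log1 by (intro mult_left_mono) auto
  then have x17: "17 * \<alpha> * (2 - \<alpha>) \<le> x" using xa by simp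
  have x0: "x > 0" using x17 alpha_pos alpha_less_1 by (smt (verit) mult_pos_pos)
  have nu: "n * \<alpha> ^ 4 \<ge> 1 + x"
  proof -
    have "1 * (1 + x) \<le> \<rho> * \<alpha> ^ 4 * (1 + x)" using rho x0 by (intro mult_right_mono) auto
    also have "\<dots> = \<rho> * (1 + x) * \<alpha> ^ 4" by simp
    also have "\<dots> \<le> n * \<alpha> ^ 4" using big alpha_pos by (intro mult_right_mono) auto
    finally show ?thesis by simp
  qed
  have rank: "n \<le> (\<rho> + 1) * (1 + c)" if "\<And>v. v \<in> V \<Longrightarrow> deg v \<le> c * lam\<^sup>2" for c
  proof -
    have "n * lam\<^sup>2 \<le> (\<rho> + 1) * (1 + c) * lam\<^sup>2"
      using card_le_of_deg_le[OF that] by (simp add: \<rho>_def algebra_simps)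
    then show ?thesis using lam_pos by simp
  qed
  show False
  proof (cases "\<alpha> \<ge> 1 / 2")
    case True
    \<comment> \<open>The product is the difference of the two sides of the next inequality.\<close>
    have "0 \<le> (1 - \<alpha>) * (17 * \<alpha> - 1)" using True alpha_less_1 by (intro mult_nonneg_nonneg) auto
    then have "1 + 17 * \<alpha> * (2 - \<alpha>) \<ge> 2 + 16 * \<alpha>" by (simp add: algebra_simps)
    moreover have x9: "x \<ge> 17 * 3 / 4"
    proof -
      have "0 \<le> (\<alpha> - 1 / 2) * (3 / 2 - \<alpha>)" using True alpha_less_1 by (intro mult_nonneg_nonneg) auto
      also have "\<dots> = \<alpha> * (2 - \<alpha>) - 3 / 4" by (simp add: field_simps)
      finally show ?thesis using x17 by linarith
    qed
    ultimately have "deg v = 0" if "v \<in> V" for v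
      using True x17 nu that by (intro deg_eq_0) linarith+
    then have "n \<le> \<rho> + 1" using rank[of 0] by simp
    moreover have "\<rho> * 3 \<le> \<rho> * (1 + x)" using x9 rho0 by (intro mult_left_mono) auto
    ultimately show False using big rho0 by linarith
  next
    case False
    have "log 2 (1 / \<alpha>) \<ge> real 1" using False alpha_pos by (intro le_log2I) (simp add: field_simps)
    then have "17 * \<alpha> * 2 \<le> 17 * \<alpha> * log 2 (2 / \<alpha>)"
      using log1 alpha_pos by (intro mult_left_mono) auto
    then have x34: "34 * \<alpha> \<le> x" using xa by simp
    \<comment> \<open>Strictness matters: an integer above 16 is at least 17, exactly what
      \<open>(\<rho> + 1) * (17 / 6) \<le> \<rho> * 3\<close> requires.\<close>
    have "2 ^ 4 \<le> (1 / \<alpha>) ^ 4" using False alpha_pos by (intro power_mono) (auto simp: field_simps)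
    moreover have "2 ^ 4 \<noteq> (1 / \<alpha>) ^ 4"
      using False alpha_pos power_eq_imp_eq_base[of 2 4 "1 / \<alpha>"] by (auto simp: field_simps)
    ultimately have "real 16 < real CARD('n)" using rho(2) by (simp add: \<rho>_def)
    then have rho17: "\<rho> \<ge> 17" unfolding \<rho>_def of_nat_less_iff by linarith
    show False
    proof (cases "x \<ge> 2")
      case True
      have "deg v \<le> 11 / 6 * lam\<^sup>2" if "v \<in> V" for v
        using True False nu x34 that by (intro deg_le_lam_sq) auto
      then have "n \<le> (\<rho> + 1) * (17 / 6)" using rank[of "11 / 6"] by simp
      moreover have "\<rho> * 3 \<le> \<rho> * (1 + x)" using True rho0 by (intro mult_left_mono) auto
      then have "\<rho> * 3 < n" using big by linarith
      moreover have "(\<rho> + 1) * (17 / 6) \<le> \<rho> * 3" using rho17 by simp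
      ultimately show False by linarith
    next
      case x2: False
      interpret ld: large_dimension \<alpha> \<rho> x n
      proof
        have "\<rho> \<le> \<rho> * (1 + x)" using rho0 x0 by simp
        then show "n \<ge> \<rho>" using big by simp
      qed (use alpha_pos alpha_less_1 r x2 in \<open>auto simp: \<rho>_def x_def\<close>)
      have lm: "ld.lm = lam" by (simp add: ld.lm_def lam_def)
      \<comment> \<open>For \<open>x < 2\<close> the bound \<open>1 + x\<close> falls short of 3.
        Instead \<open>L \<ge> 5\<close> gives \<open>n \<ge> (1 / \<alpha>) ^ 5\<close>, so the
        product is at least \<open>1 / \<alpha>\<close>.\<close>
      have nu3: "n * \<alpha> ^ 4 \<ge> 3"
      proof -
        have "(1 / \<alpha>) ^ 5 = (1 / \<alpha>) powr 5" using alpha_pos by simp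
        also have "\<dots> \<le> (1 / \<alpha>) powr ld.L" using ld.base ld.L_big by (intro powr_mono) auto
        also have "\<dots> \<le> n" by (rule ld.N_ge_powr)
        finally have "(1 / \<alpha>) ^ 5 * \<alpha> ^ 4 \<le> n * \<alpha> ^ 4" using alpha_pos by (intro mult_right_mono) auto
        moreover have "(1 / \<alpha>) ^ 5 * \<alpha> ^ 4 = 1 / \<alpha>"
          using alpha_pos by (simp add: power_one_over power_numeral_reduce)
        ultimately show ?thesis using ld.base by linarith
      qed
      define D where "D = 11 / 6 * lam\<^sup>2"
      have degD: "deg v \<le> D" if "v \<in> V" for v
        unfolding D_def using False nu3 ld.a51 that by (intro deg_le_lam_sq) auto
      have "24\<^sup>2 \<le> lam\<^sup>2" using ld.lam_bounds(1) unfolding lm by (intro power_mono) auto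
      then have D: "D \<ge> 1" "D \<le> 2 * lam\<^sup>2" by (auto simp: D_def)
      \<comment> \<open>Walks on at most \<open>k\<close> vertices count as short of vertices, so
        those to be hit meet at least \<open>k + 1 = m\<close>.\<close>
      define k where "k = ld.m - 1"
      have k: "ld.m = k + 1" "1 \<le> k" using ld.m_bounds(3) by (auto simp: k_def)
      have "real (k + 1) \<le> n" using ld.m_le_L(1) ld.N_ge_L k by simp
      then have kV: "k + 1 \<le> card V" by (simp only: of_nat_le_iff)
      have "n - \<rho> \<le> n * x / 3"
      proof (rule ld.surplus_le[where D = D and k = k])
        show "ld.lm ^ (2 * ld.s) * (n - real ld.t - (\<rho> + 1)) \<le>
            n * ((lam + 2 * D * (D + 1) ^ ld.s / n) ^ (2 * ld.s) * (1 - real ld.m / n) ^ ld.t +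
              real ld.m ^ (2 * ld.s) * D ^ k)"
          using vertex_deletion[OF degD D(1) k(2) kV refl, of ld.s ld.t]
          unfolding lm k(1) \<rho>_def[symmetric] .
      qed (use D k lm in auto)
      \<comment> \<open>The assumption \<open>\<rho> * (1 + x) < n\<close> means that
        \<open>n - \<rho>\<close> exceeds \<open>n * (x / (1 + x))\<close>, and
        \<open>1 + x < 3\<close> brings this into conflict with the surplus bound.\<close>
      moreover have "n * x / 3 \<le> n * (x / (1 + x))"
      proof -
        have "x / 3 \<le> x / (1 + x)" using x0 x2 by (intro divide_left_mono) auto
        then have "n * (x / 3) \<le> n * (x / (1 + x))" using n_pos by (intro mult_left_mono) auto
        then show ?thesis by simp
      qed
      moreover have "n * (x / (1 + x)) < n - \<rho>" using big x0 by (simp add: field_simps)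
      ultimately show False by linarith
    qed
  qed
qed

end

section \<open>From lines to maximally oriented unit vectors\<close>

lemma exists_orientation:
  fixes U :: "(real ^ 'n) set"
  assumes U: "finite U" "U \<noteq> {}" and unit: "\<And>v. v \<in> U \<Longrightarrow> v \<bullet> v = 1"
    and angle: "\<And>v w. v \<in> U \<Longrightarrow> w \<in> U \<Longrightarrow> v \<noteq> w \<Longrightarrow> \<bar>v \<bullet> w\<bar> = \<alpha>"
    and alpha: "0 < \<alpha>" "\<alpha> < 1"
  shows "\<exists>V :: (real ^ 'n) set. oriented_equiangular_vectors V \<alpha> \<and> card V = card U"
proof -
  \<comment> \<open>Extensional sign functions form a finite set, so one with the longest signed sum
    exists.\<close>
  define S where "S = (\<Pi>\<^sub>E v\<in>U. {1, -1 :: real})"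
  define val where "val s = norm (\<Sum>v\<in>U. s v *\<^sub>R v)" for s
  have S: "finite S" "S \<noteq> {}" using U by (auto simp: S_def PiE_eq_empty_iff intro!: finite_PiE)
  have "Max (val ` S) \<in> val ` S" using S by (intro Max_in) auto
  then obtain s where s: "s \<in> S" "val s = Max (val ` S)" by auto
  then have smax: "val s' \<le> val s" if "s' \<in> S" for s' using S that by simp
  have sv: "s v = 1 \<or> s v = -1" if "v \<in> U" for v using s(1) that by (auto simp: S_def)
  define V where "V = (\<lambda>v. s v *\<^sub>R v) ` U"
  have inner: "\<bar>(s v *\<^sub>R v) \<bullet> (s w *\<^sub>R w)\<bar> = \<bar>v \<bullet> w\<bar>" if "v \<in> U" "w \<in> U" for v w
    using sv[OF that(1)] sv[OF that(2)] by auto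
  have unit': "(s v *\<^sub>R v) \<bullet> (s v *\<^sub>R v) = 1" if "v \<in> U" for v
    using sv[OF that] unit[OF that] by auto
  have inj: "inj_on (\<lambda>v. s v *\<^sub>R v) U"
  proof (rule inj_onI, rule ccontr)
    fix v w assume vw: "v \<in> U" "w \<in> U" "s v *\<^sub>R v = s w *\<^sub>R w" "v \<noteq> w"
    then have "\<bar>v \<bullet> w\<bar> = 1" using inner[of v w] unit'[of w] by simp
    then show False using angle[OF vw(1,2,4)] alpha by simp
  qed
  have "oriented_equiangular_vectors V \<alpha>"
  proof
    show "finite V" "V \<noteq> {}" using U by (auto simp: V_def)
    show "v \<bullet> v = 1" if "v \<in> V" for v using that unit' by (auto simp: V_def)
    show "\<bar>v \<bullet> w\<bar> = \<alpha>" if "v \<in> V" "w \<in> V" "v \<noteq> w" for v w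
    proof -
      obtain v' w' where v': "v' \<in> U" "w' \<in> U" "v = s v' *\<^sub>R v'" "w = s w' *\<^sub>R w'"
        using \<open>v \<in> V\<close> \<open>w \<in> V\<close> unfolding V_def by blast
      then have "v' \<noteq> w'" using \<open>v \<noteq> w\<close> by auto
      then show ?thesis using angle[of v' w'] inner[of v' w'] v' by simp
    qed
    fix s' :: "real ^ 'n \<Rightarrow> real"
    assume s': "\<And>v. v \<in> V \<Longrightarrow> s' v = 1 \<or> s' v = -1"
    \<comment> \<open>Changing signs on \<open>V\<close> by \<open>s'\<close> amounts to the product
      of both signs on \<open>U\<close>; restriction makes it a member of \<open>S\<close>.\<close>
    define s'' where "s'' = restrict (\<lambda>v. s' (s v *\<^sub>R v) * s v) U"
    have "s'' \<in> S" unfolding S_def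
    proof (rule PiE_I)
      fix v assume v: "v \<in> U"
      then have "s' (s v *\<^sub>R v) = 1 \<or> s' (s v *\<^sub>R v) = -1" by (intro s') (auto simp: V_def)
      then show "s'' v \<in> {1, -1}" using sv[OF v] v by (auto simp: s''_def)
    qed (simp add: s''_def)
    then have "val s'' \<le> val s" by (rule smax)
    moreover have "val s'' = norm (\<Sum>v\<in>V. s' v *\<^sub>R v)"
      unfolding val_def V_def by (simp add: sum.reindex[OF inj] s''_def)
    moreover have "val s = norm (\<Sum>v\<in>V. v)"
      unfolding val_def V_def by (simp add: sum.reindex[OF inj])
    ultimately show "norm (\<Sum>v\<in>V. s' v *\<^sub>R v) \<le> norm (\<Sum>v\<in>V. v)" by simp
  qed (use alpha in auto)
  moreover have "card V = card U" unfolding V_def by (rule card_image[OF inj])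
  ultimately show ?thesis by blast
qed

lemma is_line_unit_vector:
  fixes L :: "'a::euclidean_space set"
  assumes "is_line L"
  obtains v where "v \<bullet> v = 1" "L = span {v}"
proof -
  have L: "subspace L" "dim L = 1" using assms by (auto simp: is_line_def)
  obtain B where B: "B \<subseteq> L" "pairwise orthogonal B" "\<And>x. x \<in> B \<Longrightarrow> norm x = 1"
    "independent B" "card B = dim L" "span B = L"
    using orthonormal_basis_subspace[OF L(1)] by metis
  then obtain v where "B = {v}" using L(2) card_1_singletonE by metis
  then show thesis using that[of v] B by (auto simp: norm_eq_1)
qed

text \<open>Scaling the spanning vectors changes the cosine by a sign only. Since
  \<open>arccos\<close> is decreasing, the infimum is attained where the cosine is
  nonnegative.\<close>

lemma line_angle_span:
  assumes u: "u \<bullet> u = 1" and w: "w \<bullet> w = 1"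
  shows "line_angle (span {u}) (span {w}) = arccos \<bar>u \<bullet> w\<bar>"
proof -
  have norms: "norm u = 1" "norm w = 1" using u w by (auto simp: norm_eq_1)
  then have uw: "\<bar>u \<bullet> w\<bar> \<le> 1" using Cauchy_Schwarz_ineq2[of u w] by simp
  have ne: "u \<noteq> 0" "w \<noteq> 0" using u w by auto
  let ?A = "{vec_angle x y | x y. x \<in> span {u} - {0} \<and> y \<in> span {w} - {0}}"
  have mem: "vec_angle (a *\<^sub>R u) (b *\<^sub>R w) \<in> ?A" if "a \<noteq> 0" "b \<noteq> 0" for a b
    using that ne by (intro CollectI exI conjI refl) (auto simp: span_singleton)
  have "arccos \<bar>u \<bullet> w\<bar> \<in> ?A"
    using mem[of 1 1] mem[of 1 "-1"] norms by (cases "u \<bullet> w \<ge> 0") (auto simp: vec_angle_def)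
  moreover have "arccos \<bar>u \<bullet> w\<bar> \<le> z" if z: "z \<in> ?A" for z
  proof -
    obtain x y where xy: "x \<in> span {u} - {0}" "y \<in> span {w} - {0}" "z = vec_angle x y"
      using z by blast
    then obtain a b where ab: "x = a *\<^sub>R u" "y = b *\<^sub>R w" "a \<noteq> 0" "b \<noteq> 0"
      by (auto simp: span_singleton)
    define c where "c = (x \<bullet> y) / (norm x * norm y)"
    have "\<bar>c\<bar> = \<bar>u \<bullet> w\<bar>" using ab norms by (simp add: c_def abs_mult)
    then have "arccos \<bar>u \<bullet> w\<bar> \<le> arccos c" using uw by (intro arccos_le_arccos) auto
    then show ?thesis using xy by (simp add: vec_angle_def c_def)
  qed
  ultimately show ?thesis unfolding line_angle_def by (intro cInf_eq_minimum)
qed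

lemma equiangular_finite_card_le:
  fixes \<L> :: "(real ^ 'n) set set"
  assumes alpha: "0 < \<alpha>" "\<alpha> < 1" and r: "real CARD('n) \<ge> 1 / \<alpha> ^ 4"
    and eq: "equiangular \<alpha> \<L>" and fin: "finite \<L>" "\<L> \<noteq> {}"
  shows "real (card \<L>) \<le> real CARD('n) + real CARD('n) *
    max (66 * (log 2 (log (1 / \<alpha>) (real CARD('n))))\<^sup>2 / log (1 / \<alpha>) (real CARD('n)))
      (17 * \<alpha> * log 2 (2 / \<alpha>))"
proof -
  have "\<forall>L\<in>\<L>. \<exists>v. v \<bullet> v = 1 \<and> L = span {v}"
    using eq by (auto simp: equiangular_def elim!: is_line_unit_vector)
  then obtain v where v: "\<And>L. L \<in> \<L> \<Longrightarrow> v L \<bullet> v L = 1" "\<And>L. L \<in> \<L> \<Longrightarrow> L = span {v L}"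
    by (auto dest!: bchoice)
  have inj: "inj_on v \<L>"
    using v(2)[symmetric] by (rule inj_on_inverseI)
  have angle: "\<bar>v L \<bullet> v M\<bar> = \<alpha>" if "L \<in> \<L>" "M \<in> \<L>" "L \<noteq> M" for L M
  proof -
    have "arccos \<alpha> = line_angle L M" using eq that by (simp add: equiangular_def)
    also have "\<dots> = line_angle (span {v L}) (span {v M})"
      using v(2)[OF that(1)] v(2)[OF that(2)] by (rule arg_cong2)
    also have "\<dots> = arccos \<bar>v L \<bullet> v M\<bar>" using v(1) that by (intro line_angle_span) auto
    finally have "cos (arccos \<alpha>) = cos (arccos \<bar>v L \<bullet> v M\<bar>)" by simp
    moreover have "\<bar>v L \<bullet> v M\<bar> \<le> 1"
      using Cauchy_Schwarz_ineq2[of "v L" "v M"] v(1)[OF that(1)] v(1)[OF that(2)]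
      by (simp add: norm_eq_sqrt_inner)
    ultimately show ?thesis using alpha by (simp add: cos_arccos)
  qed
  have "\<exists>V :: (real ^ 'n) set. oriented_equiangular_vectors V \<alpha> \<and> card V = card (v ` \<L>)"
    using fin v(1) angle alpha by (intro exists_orientation) auto
  then obtain V :: "(real ^ 'n) set"
    where V: "oriented_equiangular_vectors V \<alpha>" "card V = card (v ` \<L>)" by blast
  show ?thesis
    using oriented_equiangular_vectors.card_bound[OF V(1) r] V(2) card_image[OF inj] by simp
qed

theorem theorem3p5:
  fixes \<alpha> :: real and r :: nat and \<L> :: "(real ^ 'n) set set"
  assumes "0 < \<alpha>" and "\<alpha> < 1"
    and "r = CARD('n)"
    and "real r \<ge> 1 / \<alpha> ^ 4"
    and "equiangular \<alpha> \<L>"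
  shows "finite \<L> \<and>
    real (card \<L>) \<le> real r + real r *
      max (66 * (log 2 (log (1 / \<alpha>) (real r)))\<^sup>2 / log (1 / \<alpha>) (real r))
          (17 * \<alpha> * log 2 (2 / \<alpha>))"
proof -
  define b where "b = real r + real r *
      max (66 * (log 2 (log (1 / \<alpha>) (real r)))\<^sup>2 / log (1 / \<alpha>) (real r))
          (17 * \<alpha> * log 2 (2 / \<alpha>))"
  \<comment> \<open>Positivity of the second entry of the maximum makes \<open>b\<close>
    nonnegative, which covers the empty subfamily.\<close>
  have "0 < log 2 (2 / \<alpha>)" using assms by simp
  then have "0 \<le> 17 * \<alpha> * log 2 (2 / \<alpha>)" using assms by simp
  then have b0: "0 \<le> b" unfolding b_def by (intro add_nonneg_nonneg mult_nonneg_nonneg) auto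
  have sub: "real (card F) \<le> b" if "F \<subseteq> \<L>" "finite F" for F
  proof (cases "F = {}")
    case False
    have eqF: "equiangular \<alpha> F"
      unfolding equiangular_def
    proof (intro conjI ballI impI)
      fix L assume L: "L \<in> F"
      then have "L \<in> \<L>" using that(1) by (rule set_mp[rotated])
      then show "is_line L" using assms(5) unfolding equiangular_def by simp
      fix M assume "M \<in> F" "L \<noteq> M"
      moreover have "M \<in> \<L>" using that(1) \<open>M \<in> F\<close> by (rule set_mp)
      ultimately show "line_angle L M = arccos \<alpha>"
        using assms(5) \<open>L \<in> \<L>\<close> unfolding equiangular_def by simp
    qed
    have r: "real CARD('n) \<ge> 1 / \<alpha> ^ 4" using assms(4) unfolding assms(3) .
    show ?thesis
      unfolding b_def assms(3) by (rule equiangular_finite_card_le[OF assms(1,2) r eqF that(2) False])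
  qed (use b0 in simp)
  \<comment> \<open>A uniform bound on the finite subfamilies shows that the family itself is
    finite, and the bound then applies to it.\<close>
  have "card F \<le> nat \<lfloor>b\<rfloor>" if "F \<subseteq> \<L>" "finite F" for F
    using sub[OF that] by (rule le_nat_floor)
  then have "finite \<L>" using finite_if_finite_subsets_card_bdd[of \<L>] by blast
  then show ?thesis using sub[of \<L>] by (simp add: b_def)
qed

end
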